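(* (Spanning set condition.) Let $A=\bigoplus_{i\in\mathsf{I}}X_i^\dagger X_i$ be a point of $\mathsf{C}$, with $X_i\in\mathcal{B}(\mathcal{H})$, let $\mathcal{H}_i=\mathrm{Rng}(X_i)$ be the range of $X_i$, and let $$F_{kl}^{\mu}=\bigoplus_{i\in\mathsf{I}}X_i\,T_{kl}^{\mu}\,X_i^\dagger\ \in\ \bigoplus_{i\in\mathsf{I}}\mathcal{B}(\mathcal{H}_i),\qquad \mathsf{F}=\{F_{kl}^\mu\mid \mu\in\mathsf{S},\ k,l=1,\dots,m_\mu\}.$$ Then $A$ is an extreme point of $\mathsf{C}$ if and only if the complex linear span of $\mathsf{F}$ satisfies $$\mathrm{Span}(\mathsf{F})=\bigoplus_{i\in\mathsf{I}}\mathcal{B}(\mathcal{H}_i).$$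
   Context: $\mathbf{G}$ is a compact Lie group (finite groups included) with Haar measure $dg$ normalized by $\int_{\mathbf{G}}dg=1$. $\mathcal{H}$ is a finite-dimensional complex Hilbert space and $\{U_g\mid g\in\mathbf{G}\}$ is a (generally projective) unitary representation of $\mathbf{G}$ on $\mathcal{H}$, with $g\mapsto U_gXU_g^\dagger$ continuous for every operator $X$. $\mathcal{B}(\mathcal{K})$ denotes the linear operators on $\mathcal{K}$. $\mathsf{S}$ is the set of equivalence classes of irreducible representations occurring in $\{U_g\}$; $\mathcal{H}=\bigoplus_{\mu\in\mathsf{S}}\bigoplus_{k=1}^{m_\mu}\mathcal{H}_k^\mu$ is a fixed orthogonal decomposition into irreducible subspaces, where $\mathcal{H}_k^\mu$ carries an irrep of class $\mu$, of dimension $d_\mu$, and $m_\mu$ is the multiplicity of $\mu$. For $k,l=1,\dots,m_\mu$, $T_{kl}^\mu\in\mathcal{B}(\mathcal{H})$ is the invariant isomorphism $\mathcal{H}_l^\mu\to\mathcal{H}_k^\mu$: a partial isometry with support $\mathcal{H}_l^\mu$ and range $\mathcal{H}_k^\mu$, commuting with all $U_g$, chosen so that $T^\mu_{kk}$ is the orthogonal projection onto $\mathcal{H}^\mu_k$ and $T^\mu_{kl}T^\mu_{ln}=T^\mu_{kn}$. $\mathsf{I}$ is a finite index set, and $\mathcal{W}_i\simeq\mathcal{H}$ is a copy of $\mathcal{H}$ for each $i\in\mathsf{I}$. A block operator is an element $A=\bigoplus_{i\in\mathsf{I}}A_i$ of $\bigoplus_{i\in\mathsf{I}}\mathcal{B}(\mathcal{W}_i)$.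 The convex set $\mathsf{C}$ consists of all block operators $A$ with $A\ge 0$ and $$\sum_{i\in\mathsf{I}}\int_{\mathbf{G}}dg\,U_gA_iU_g^\dagger=1_{\mathcal H}.$$ ($\mathsf{C}$ is in affine bijection with the covariant POVMs with outcome space $\mathsf{I}\times\mathbf{G}$, with operator density $M(i,g)=U_gA_iU_g^\dagger$.) The operator $X_iT_{kl}^\mu X_i^\dagger$ is regarded as an operator on $\mathcal{H}_i=\mathrm{Rng}(X_i)$ by restriction. *)

theory Defs
  imports "HOL-Analysis.Analysis" "HOL-Algebra.Coset"
begin

section \<open>Compact Lie groups and their Haar measure\<close>

text \<open>On an open subset of a finite-dimensional space, \<open>C_n_on n S f\<close> says that all iterated
  directional derivatives of \<open>f\<close> of order at most \<open>n\<close> exist and are continuous.\<close>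

primrec C_n_on :: "nat \<Rightarrow> 'a::real_normed_vector set \<Rightarrow> ('a \<Rightarrow> 'b::real_normed_vector) \<Rightarrow> bool" where
  "C_n_on 0 S f \<longleftrightarrow> continuous_on S f"
| "C_n_on (Suc n) S f \<longleftrightarrow>
     (\<forall>x\<in>S. f differentiable (at x)) \<and> (\<forall>v. C_n_on n S (\<lambda>x. frechet_derivative f (at x) v))"

definition smooth_on :: "'a::real_normed_vector set \<Rightarrow> ('a \<Rightarrow> 'b::real_normed_vector) \<Rightarrow> bool" where
  "smooth_on S f \<longleftrightarrow> (\<forall>n. C_n_on n S f)"

text \<open>A chart is a pair \<open>(D, \<phi>)\<close> of an open domain and a homeomorphism onto an open subset of the
  model space \<open>'e\<close>. The class \<^class>\<open>euclidean_space\<close> is not used for \<open>'e\<close> because it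
  excludes dimension \<open>0\<close>, that is, discrete (in the compact case: finite) groups.\<close>

definition smooth_atlas :: "'g topology \<Rightarrow> ('g set \<times> ('g \<Rightarrow> 'e::real_normed_vector)) set \<Rightarrow> bool" where
  "smooth_atlas X \<Phi> \<longleftrightarrow>
     (\<exists>B::'e set. finite B \<and> span B = UNIV) \<and>
     (\<forall>(D, \<phi>)\<in>\<Phi>. openin X D \<and> open (\<phi> ` D) \<and>
        homeomorphic_map (subtopology X D) (top_of_set (\<phi> ` D)) \<phi>) \<and>
     (\<Union>(D, \<phi>)\<in>\<Phi>. D) = topspace X \<and>
     (\<forall>(D, \<phi>)\<in>\<Phi>. \<forall>(E, \<psi>)\<in>\<Phi>. smooth_on (\<phi> ` (D \<inter> E)) (\<psi> \<circ> inv_into D \<phi>))"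

locale compact_lie_group = group G
  for G :: "('g, 'b) monoid_scheme" (structure)
    and X :: "'g topology"
    and \<Phi> :: "('g set \<times> ('g \<Rightarrow> 'e::real_normed_vector)) set" +
  assumes topspace_eq: "topspace X = carrier G"
    and compact_space: "compact_space X"
    and Hausdorff_space: "Hausdorff_space X"
    and second_countable: "second_countable X"
    and smooth_atlas: "smooth_atlas X \<Phi>"
    and continuous_mult: "continuous_map (prod_topology X X) X (\<lambda>(x, y). x \<otimes> y)"
    and continuous_inv: "continuous_map X X (\<lambda>x. inv x)"
    and smooth_mult: "\<And>D \<phi> E \<psi> W \<theta>. \<lbrakk>(D, \<phi>) \<in> \<Phi>; (E, \<psi>) \<in> \<Phi>; (W, \<theta>) \<in> \<Phi>\<rbrakk> \<Longrightarrow>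
      smooth_on {(\<phi> x, \<psi> y) | x y. x \<in> D \<and> y \<in> E \<and> x \<otimes> y \<in> W}
        (\<lambda>(a, b). \<theta> (inv_into D \<phi> a \<otimes> inv_into E \<psi> b))"
    and smooth_inv: "\<And>D \<phi> E \<psi>. \<lbrakk>(D, \<phi>) \<in> \<Phi>; (E, \<psi>) \<in> \<Phi>\<rbrakk> \<Longrightarrow>
      smooth_on {\<phi> x | x. x \<in> D \<and> inv x \<in> E} (\<lambda>a. \<psi> (inv (inv_into D \<phi> a)))"

definition normalized_haar_measure ::
    "('g, 'b) monoid_scheme \<Rightarrow> 'g topology \<Rightarrow> 'g measure \<Rightarrow> bool" where
  "normalized_haar_measure G X \<nu> \<longleftrightarrow>
     space \<nu> = topspace X \<and>
     sets \<nu> = sigma_sets (topspace X) {S. openin X S} \<and>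
     emeasure \<nu> (space \<nu>) = 1 \<and>
     (\<forall>h\<in>carrier G. \<forall>E\<in>sets \<nu>. emeasure \<nu> (h <#\<^bsub>G\<^esub> E) = emeasure \<nu> E)"


section \<open>Operators on a finite-dimensional complex Hilbert space\<close>

text \<open>The Hilbert space is \<open>complex ^ 'n\<close>, its operators are the matrices \<open>complex ^ 'n ^ 'n\<close>.
  The norm of \<open>complex ^ 'n\<close> is the one induced by the following inner product.\<close>

definition cinner :: "complex ^ 'n \<Rightarrow> complex ^ 'n \<Rightarrow> complex" where
  "cinner x y = (\<Sum>i\<in>UNIV. cnj (x $ i) * y $ i)"

definition adj :: "complex ^ 'n ^ 'm \<Rightarrow> complex ^ 'm ^ 'n" where
  "adj A = map_matrix cnj (transpose A)"

definition positive_op :: "complex ^ 'n ^ 'n \<Rightarrow> bool" where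
  "positive_op A \<longleftrightarrow> (\<forall>x. cinner x (A *v x) \<in> \<real>\<^sub>\<ge>\<^sub>0)"

definition unitary_op :: "complex ^ 'n ^ 'n \<Rightarrow> bool" where
  "unitary_op A \<longleftrightarrow> adj A ** A = mat 1 \<and> A ** adj A = mat 1"

definition orth_compl :: "(complex ^ 'n) set \<Rightarrow> (complex ^ 'n) set" where
  "orth_compl K = {x. \<forall>y\<in>K. cinner y x = 0}"

definition orth_proj_onto :: "complex ^ 'n ^ 'n \<Rightarrow> (complex ^ 'n) set \<Rightarrow> bool" where
  "orth_proj_onto P K \<longleftrightarrow> (\<forall>x\<in>K. P *v x = x) \<and> (\<forall>x\<in>orth_compl K. P *v x = 0)"

definition partial_isometry :: "complex ^ 'n ^ 'n \<Rightarrow> (complex ^ 'n) set \<Rightarrow> (complex ^ 'n) set \<Rightarrow> bool"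
  where \<comment> \<open>with support \<open>K\<close> and range \<open>L\<close>\<close>
  "partial_isometry V K L \<longleftrightarrow>
     (\<forall>x\<in>K. norm (V *v x) = norm x) \<and> (\<forall>x\<in>orth_compl K. V *v x = 0) \<and> range ((*v) V) = L"

text \<open>The algebra of operators on a subspace \<open>K\<close>, each of them extended by \<open>0\<close> on the orthogonal
  complement of \<open>K\<close>. By the lemma \<open>bij_betw_restrict_ops_on\<close> below, restriction to \<open>K\<close>
  identifies \<open>ops_on K\<close> with the set of all linear maps from \<open>K\<close> to \<open>K\<close>.\<close>

definition ops_on :: "(complex ^ 'n) set \<Rightarrow> (complex ^ 'n ^ 'n) set" where
  "ops_on K = {B. (\<forall>x\<in>K. B *v x \<in> K) \<and> (\<forall>x\<in>orth_compl K. B *v x = 0)}"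


section \<open>Projective unitary representations\<close>

definition projective_unitary_rep ::
    "('g, 'b) monoid_scheme \<Rightarrow> 'g topology \<Rightarrow> ('g \<Rightarrow> complex ^ 'n ^ 'n) \<Rightarrow> bool" where
  "projective_unitary_rep G X U \<longleftrightarrow>
     (\<forall>g\<in>carrier G. unitary_op (U g)) \<and>
     (\<forall>g\<in>carrier G. \<forall>h\<in>carrier G. \<exists>\<omega>. cmod \<omega> = 1 \<and>
        U (g \<otimes>\<^bsub>G\<^esub> h) = map_matrix ((*) \<omega>) (U g ** U h)) \<and>
     (\<forall>Y. continuous_map X euclidean (\<lambda>g. U g ** Y ** adj (U g)))"

definition invariant_subspace ::
    "('g, 'b) monoid_scheme \<Rightarrow> ('g \<Rightarrow> complex ^ 'n ^ 'n) \<Rightarrow> (complex ^ 'n) set \<Rightarrow> bool" where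
  "invariant_subspace G U K \<longleftrightarrow> vec.subspace K \<and> (\<forall>g\<in>carrier G. \<forall>x\<in>K. U g *v x \<in> K)"

definition irreducible_subspace ::
    "('g, 'b) monoid_scheme \<Rightarrow> ('g \<Rightarrow> complex ^ 'n ^ 'n) \<Rightarrow> (complex ^ 'n) set \<Rightarrow> bool" where
  "irreducible_subspace G U K \<longleftrightarrow> invariant_subspace G U K \<and> K \<noteq> {0} \<and>
     (\<forall>L. invariant_subspace G U L \<and> L \<subseteq> K \<longrightarrow> L = {0} \<or> L = K)"

text \<open>Irreducible subrepresentations share the multiplier of \<open>U\<close>, so they are equivalent iff there
  is an invertible intertwiner in the strict sense, without additional phases. Every linear
  map on a subspace is the restriction of a matrix.\<close>

definition equivalent_irreps ::
    "('g, 'b) monoid_scheme \<Rightarrow> ('g \<Rightarrow> complex ^ 'n ^ 'n) \<Rightarrow>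
      ((complex ^ 'n) set \<times> (complex ^ 'n) set) set" where
  "equivalent_irreps G U = {(K, L). irreducible_subspace G U K \<and> irreducible_subspace G U L \<and>
     (\<exists>V. bij_betw ((*v) V) K L \<and>
        (\<forall>g\<in>carrier G. \<forall>x\<in>K. V *v (U g *v x) = U g *v (V *v x)))}"

definition irrep_classes ::
    "('g, 'b) monoid_scheme \<Rightarrow> ('g \<Rightarrow> complex ^ 'n ^ 'n) \<Rightarrow> (complex ^ 'n) set set set" where
  "irrep_classes G U = Collect (irreducible_subspace G U) // equivalent_irreps G U"

definition irreducible_decomposition ::
    "('g, 'b) monoid_scheme \<Rightarrow> ('g \<Rightarrow> complex ^ 'n ^ 'n) \<Rightarrow>
      ((complex ^ 'n) set set \<Rightarrow> nat) \<Rightarrow> ((complex ^ 'n) set set \<Rightarrow> nat \<Rightarrow> (complex ^ 'n) set) \<Rightarrow> bool"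
  where
  "irreducible_decomposition G U m H \<longleftrightarrow>
     (\<forall>\<mu>\<in>irrep_classes G U. \<forall>k\<in>{1..m \<mu>}. H \<mu> k \<in> \<mu>) \<and>
     (\<forall>\<mu>\<in>irrep_classes G U. \<forall>k\<in>{1..m \<mu>}. \<forall>\<mu>'\<in>irrep_classes G U. \<forall>k'\<in>{1..m \<mu>'}.
        (\<mu>, k) \<noteq> (\<mu>', k') \<longrightarrow> (\<forall>x\<in>H \<mu> k. \<forall>y\<in>H \<mu>' k'. cinner x y = 0)) \<and>
     vec.span (\<Union>\<mu>\<in>irrep_classes G U. \<Union>k\<in>{1..m \<mu>}. H \<mu> k) = UNIV"

definition invariant_isomorphisms ::
    "('g, 'b) monoid_scheme \<Rightarrow> ('g \<Rightarrow> complex ^ 'n ^ 'n) \<Rightarrow>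
      ((complex ^ 'n) set set \<Rightarrow> nat) \<Rightarrow> ((complex ^ 'n) set set \<Rightarrow> nat \<Rightarrow> (complex ^ 'n) set) \<Rightarrow>
      ((complex ^ 'n) set set \<Rightarrow> nat \<Rightarrow> nat \<Rightarrow> complex ^ 'n ^ 'n) \<Rightarrow> bool" where
  "invariant_isomorphisms G U m H T \<longleftrightarrow> (\<forall>\<mu>\<in>irrep_classes G U. \<forall>k\<in>{1..m \<mu>}. \<forall>l\<in>{1..m \<mu>}.
     partial_isometry (T \<mu> k l) (H \<mu> l) (H \<mu> k) \<and>
     (\<forall>g\<in>carrier G. T \<mu> k l ** U g = U g ** T \<mu> k l) \<and>
     orth_proj_onto (T \<mu> k k) (H \<mu> k) \<and>
     (\<forall>n\<in>{1..m \<mu>}. T \<mu> k l ** T \<mu> l n = T \<mu> k n))"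


section \<open>Block operators\<close>

text \<open>The block operator with blocks \<open>A\<^sub>i\<close> is the vector of matrices \<open>\<chi> i. A\<^sub>i\<close>; this makes
  the real vector space structure used by \<^const>\<open>extreme_point_of\<close> available.\<close>

definition block_scale ::
    "complex \<Rightarrow> ((complex ^ 'n ^ 'n), 'i::finite) vec \<Rightarrow> ((complex ^ 'n ^ 'n), 'i) vec" where
  "block_scale c A = (\<chi> i. map_matrix ((*) c) (A $ i))"

global_interpretation block: vector_space block_scale
  by unfold_locales
    (simp_all add: block_scale_def vec_eq_iff algebra_simps)

definition covariant_set ::
    "'g measure \<Rightarrow> ('g \<Rightarrow> complex ^ 'n ^ 'n) \<Rightarrow> ((complex ^ 'n ^ 'n), 'i::finite) vec set" where
  "covariant_set \<nu> U = {A. (\<forall>i. positive_op (A $ i)) \<and>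
     (\<Sum>i\<in>UNIV. LINT g|\<nu>. U g ** A $ i ** adj (U g)) = mat 1}"

definition F_op ::
    "('i::finite \<Rightarrow> complex ^ 'n ^ 'n) \<Rightarrow> complex ^ 'n ^ 'n \<Rightarrow> ((complex ^ 'n ^ 'n), 'i) vec" where
  "F_op X T = (\<chi> i. X i ** T ** adj (X i))"

definition block_ops_on ::
    "('i::finite \<Rightarrow> (complex ^ 'n) set) \<Rightarrow> ((complex ^ 'n ^ 'n), 'i) vec set" where
  "block_ops_on K = {B. \<forall>i. B $ i \<in> ops_on (K i)}"


section \<open>Operators on a subspace and their extension by zero\<close>

lemma inner_eq_Re_cinner: "x \<bullet> y = Re (cinner x y)"
  by (simp add: inner_vec_def cinner_def inner_complex_def)

lemma norm_eq_cinner: "complex_of_real ((norm x)\<^sup>2) = cinner x x"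
proof -
  have "cinner x x = (\<Sum>i\<in>UNIV. complex_of_real ((cmod (x $ i))\<^sup>2))"
    unfolding cinner_def by (intro sum.cong refl) (metis complex_norm_square mult.commute of_real_power)
  then show ?thesis
    by (simp add: norm_vec_def L2_set_def sum_nonneg)
qed

lemma cinner_scale_left: "cinner (c *s x) y = cnj c * cinner x y"
  by (simp add: cinner_def sum_distrib_left mult.assoc)

lemma cinner_adj: "cinner x (A *v y) = cinner (adj A *v x) y"
proof -
  have "cinner x (A *v y) = (\<Sum>i\<in>UNIV. \<Sum>j\<in>UNIV. cnj (x $ i) * (A $ i $ j * y $ j))"
    by (simp add: cinner_def matrix_vector_mult_def sum_distrib_left)
  also have "\<dots> = (\<Sum>j\<in>UNIV. \<Sum>i\<in>UNIV. cnj (x $ i) * (A $ i $ j * y $ j))"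
    by (rule sum.swap)
  also have "\<dots> = cinner (adj A *v x) y"
    by (simp add: cinner_def matrix_vector_mult_def adj_def transpose_def sum_distrib_right
        mult.assoc mult.left_commute)
  finally show ?thesis .
qed

lemma subspace_if_vec_subspace:
  fixes K :: "(complex ^ 'n) set"
  assumes "vec.subspace K"
  shows "subspace K"
proof -
  have *: "c *\<^sub>R x = complex_of_real c *s x" for c and x :: "complex ^ 'n"
    by (simp add: vec_eq_iff complex_eq_iff)
  show ?thesis
    using assms unfolding subspace_def vec.subspace_def * by blast
qed

lemma orth_compl_iff_orthogonal:
  assumes "vec.subspace K"
  shows "x \<in> orth_compl K \<longleftrightarrow> (\<forall>y\<in>K. orthogonal y x)"
proof
  assume "x \<in> orth_compl K"
  then show "\<forall>y\<in>K. orthogonal y x"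
    by (simp add: orth_compl_def orthogonal_def inner_eq_Re_cinner)
next
  assume o: "\<forall>y\<in>K. orthogonal y x"
  have "cinner y x = 0" if "y \<in> K" for y
  proof -
    have "Re (cinner y x) = 0"
      using o that by (simp add: orthogonal_def inner_eq_Re_cinner)
    moreover have "\<i> *s y \<in> K"
      using assms that by (simp add: vec.subspace_scale)
    then have "Re (cinner (\<i> *s y) x) = 0"
      using o by (simp add: orthogonal_def inner_eq_Re_cinner)
    then have "Im (cinner y x) = 0"
      by (simp add: cinner_scale_left)
    ultimately show ?thesis by (simp add: complex_eq_iff)
  qed
  then show "x \<in> orth_compl K" by (simp add: orth_compl_def)
qed

lemma orth_decomposition:
  assumes "vec.subspace K"
  obtains y z where "y \<in> K" "z \<in> orth_compl K" "x = y + z"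
proof -
  from orthogonal_subspace_decomp_exists[of K x] obtain y z
    where "y \<in> span K" "\<And>w. w \<in> span K \<Longrightarrow> orthogonal z w" "x = y + z" by blast
  moreover have "span K = K"
    using assms subspace_if_vec_subspace span_eq_iff by blast
  ultimately have "y \<in> K" "z \<in> orth_compl K" "x = y + z"
    using orth_compl_iff_orthogonal[OF assms] by (auto simp: orthogonal_commute)
  then show ?thesis by (rule that)
qed

lemma vec_subspace_orth_compl: "vec.subspace (orth_compl K)"
  by (auto simp: vec.subspace_def orth_compl_def cinner_def distrib_left sum.distrib
      mult.left_commute simp flip: sum_distrib_left)

lemma orth_compl_disjoint:
  assumes "x \<in> K" "x \<in> orth_compl K"
  shows "x = 0"
  using assms norm_eq_cinner[of x] by (auto simp: orth_compl_def)

text \<open>The blocks of \<open>F_op X T\<close> act on the ranges of the \<open>X i\<close>.\<close>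

lemma F_op_in_block_ops_on: "F_op X T \<in> block_ops_on (\<lambda>i. range ((*v) (X i)))"
proof -
  have "adj (X i) *v x = 0" if "x \<in> orth_compl (range ((*v) (X i)))" for i x
  proof -
    have "adj (adj (X i)) = X i"
      by (simp add: adj_def vec_eq_iff transpose_def)
    then have "cinner (adj (X i) *v x) (adj (X i) *v x) = cinner (X i *v (adj (X i) *v x)) x"
      by (simp add: cinner_adj[of "adj (X i) *v x" "adj (X i)" x])
    also have "\<dots> = 0"
      using that by (simp add: orth_compl_def)
    finally show ?thesis
      using norm_eq_cinner[of "adj (X i) *v x"] by simp
  qed
  then show ?thesis
    by (auto simp: block_ops_on_def ops_on_def F_op_def simp flip: matrix_vector_mul_assoc)
qed

lemma bij_betw_restrict_ops_on:
  fixes K :: "(complex ^ 'n) set"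
  assumes K: "vec.subspace K"
  shows "bij_betw (\<lambda>B. restrict ((*v) B) K) (ops_on K)
    {f \<in> K \<rightarrow>\<^sub>E K. (\<forall>x\<in>K. \<forall>y\<in>K. f (x + y) = f x + f y) \<and> (\<forall>c. \<forall>x\<in>K. f (c *s x) = c *s f x)}"
    (is "bij_betw ?r _ ?L")
proof (rule bij_betw_imageI)
  show "inj_on ?r (ops_on K)"
  proof (rule inj_onI)
    fix A B assume A: "A \<in> ops_on K" and B: "B \<in> ops_on K" and eq: "?r A = ?r B"
    have "A *v x = B *v x" for x
    proof -
      obtain y z where yz: "y \<in> K" "z \<in> orth_compl K" "x = y + z"
        using orth_decomposition[OF K] .
      have "A *v y = B *v y"
        using fun_cong[OF eq, of y] yz by simp
      moreover have "A *v z = 0" "B *v z = 0"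
        using A B yz by (simp_all add: ops_on_def)
      ultimately show ?thesis
        by (simp add: yz(3) matrix_vector_right_distrib)
    qed
    then show "A = B" by (simp add: matrix_eq)
  qed
  show "?r ` ops_on K = ?L"
  proof
    show "?r ` ops_on K \<subseteq> ?L"
      using K by (auto simp: ops_on_def vec.subspace_add vec.subspace_scale
          matrix_vector_right_distrib vector_scalar_commute)
    show "?L \<subseteq> ?r ` ops_on K"
    proof
      fix f assume f: "f \<in> ?L"
      define p where "p x = (SOME y. y \<in> K \<and> x - y \<in> orth_compl K)" for x
      have p: "p x \<in> K \<and> x - p x \<in> orth_compl K" for x
      proof -
        obtain y z where "y \<in> K" "z \<in> orth_compl K" "x = y + z"
          using orth_decomposition[OF K] .
        then have "y \<in> K \<and> x - y \<in> orth_compl K" by simp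
        then show ?thesis unfolding p_def by (rule someI)
      qed
      have p_eq: "p x = y" if "y \<in> K" "x - y \<in> orth_compl K" for x y
      proof -
        have "p x - y \<in> K"
          using K p that by (simp add: vec.subspace_diff)
        moreover have "p x - y = (x - y) - (x - p x)" by simp
        then have "p x - y \<in> orth_compl K"
          using p that vec.subspace_diff[OF vec_subspace_orth_compl] by metis
        ultimately have "p x - y = 0" by (rule orth_compl_disjoint)
        then show ?thesis by simp
      qed
      have p_add: "p (x + y) = p x + p y" for x y
      proof (rule p_eq)
        show "p x + p y \<in> K" using K p by (simp add: vec.subspace_add)
        have "x + y - (p x + p y) = (x - p x) + (y - p y)" by simp
        then show "x + y - (p x + p y) \<in> orth_compl K"
          using p vec.subspace_add[OF vec_subspace_orth_compl] by metis
      qed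
      have p_scale: "p (c *s x) = c *s p x" for c x
      proof (rule p_eq)
        show "c *s p x \<in> K" using K p by (simp add: vec.subspace_scale)
        have "c *s x - c *s p x = c *s (x - p x)" by (simp add: vec.scale_right_diff_distrib)
        then show "c *s x - c *s p x \<in> orth_compl K"
          using p vec.subspace_scale[OF vec_subspace_orth_compl] by metis
      qed
      have lin: "Vector_Spaces.linear (*s) (*s) (\<lambda>x. f (p x))"
        using f p by unfold_locales (auto simp: p_add p_scale)
      define B where "B = matrix (\<lambda>x. f (p x))"
      have B: "B *v x = f (p x)" for x
        unfolding B_def by (rule matrix_works[OF lin])
      have on_K: "B *v x = f x" if "x \<in> K" for x
        using that p_eq[of x x] by (simp add: B vec.subspace_0[OF vec_subspace_orth_compl])
      have f0: "f 0 = 0"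
        using f vec.subspace_0[OF K] by (metis (mono_tags, lifting) add_cancel_right_right mem_Collect_eq)
      have "B *v x = 0" if "x \<in> orth_compl K" for x
        using that p_eq[of 0 x] vec.subspace_0[OF K] by (simp add: B f0)
      then have "B \<in> ops_on K"
        using f on_K by (auto simp: ops_on_def)
      moreover have "?r B = f"
        using f on_K by (auto simp: restrict_def PiE_def extensional_def)
      ultimately show "f \<in> ?r ` ops_on K" by blast
    qed
  qed
qed

end

theory Submission
  imports Defs
begin

text \<open>
  Write \<open>E\<close> for the average over the group and let \<open>Z\<close> be a block operator. Averages lie in the
  commutant of the representation, and by Schur's lemma the \<open>T \<mu> k l\<close> separate the commutant in the
  trace pairing. As \<open>tr (T E(Y)) = tr (T Y)\<close> for \<open>T\<close> in the commutant, \<open>E(\<Sum>\<^sub>i X\<^sub>i\<^sup>\<dagger> Z\<^sub>i X\<^sub>i) = 0\<close> holds iff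
  \<open>Z\<close> annihilates all \<open>F\<close> in the trace pairing. On the other hand, the directions in which \<open>A\<close> can
  be moved both ways inside the convex set are the self-adjoint \<open>\<Oplus>\<^sub>i X\<^sub>i\<^sup>\<dagger> Z\<^sub>i X\<^sub>i\<close> of average zero. Hence
  \<open>A\<close> is extreme iff no nonzero \<open>Z\<close> on the ranges annihilates the span of the \<open>F\<close>.
\<close>

section \<open>Operators\<close>

lemma adj_nth [simp]: "adj A $ i $ j = cnj (A $ j $ i)"
  by (simp add: adj_def transpose_def)

lemma adj_adj [simp]: "adj (adj A) = A"
  by (simp add: vec_eq_iff)

lemma adj_mult: "adj (A ** B) = adj B ** adj A"
  by (simp add: vec_eq_iff matrix_matrix_mult_def mult.commute)

lemma adj_add: "adj (A + B) = adj A + adj B"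
  by (simp add: vec_eq_iff)

lemma adj_diff: "adj (A - B) = adj A - adj B"
  by (simp add: vec_eq_iff)

lemma adj_scale: "adj (map_matrix ((*) c) A) = map_matrix ((*) (cnj c)) (adj A)"
  by (simp add: vec_eq_iff)

lemma matrix_mult_scale_left:
  fixes A :: "complex ^ 'n ^ 'm"
  shows "map_matrix ((*) c) A ** B = map_matrix ((*) c) (A ** B)"
  by (simp add: vec_eq_iff matrix_matrix_mult_def sum_distrib_left mult.assoc)

lemma matrix_mult_scale_right:
  fixes A :: "complex ^ 'n ^ 'm"
  shows "A ** map_matrix ((*) c) B = map_matrix ((*) c) (A ** B)"
  by (simp add: vec_eq_iff matrix_matrix_mult_def sum_distrib_left mult.left_commute)

lemma matrix_vector_mult_scale:
  fixes A :: "complex ^ 'n ^ 'm"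
  shows "map_matrix ((*) c) A *v x = c *s (A *v x)"
  by (simp add: vec_eq_iff matrix_vector_mult_def sum_distrib_left mult.assoc)

lemma scaleR_matrix_eq:
  fixes A :: "complex ^ 'n ^ 'm"
  shows "r *\<^sub>R A = map_matrix ((*) (complex_of_real r)) A"
  by (simp add: vec_eq_iff complex_eq_iff)

lemma scaleR_vec_eq: "r *\<^sub>R x = complex_of_real r *s x"
  by (simp add: vec_eq_iff complex_eq_iff)

lemma matrix_sum_left:
  fixes B :: "'i \<Rightarrow> complex ^ 'n ^ 'm"
  shows "A ** (\<Sum>i\<in>I. B i) = (\<Sum>i\<in>I. A ** B i)"
  by (induction I rule: infinite_finite_induct) (simp_all add: matrix_add_ldistrib)

lemma matrix_add_rdistrib: "(A + B) ** C = A ** C + B ** (C :: complex ^ 'n ^ 'm)"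
  by (simp add: vec_eq_iff matrix_matrix_mult_def distrib_right sum.distrib)

lemma matrix_diff_ldistrib: "A ** (B - C) = A ** B - A ** (C :: complex ^ 'n ^ 'm)"
  by (simp add: vec_eq_iff matrix_matrix_mult_def right_diff_distrib sum_subtractf)

lemma matrix_diff_rdistrib: "(A - B) ** C = A ** C - B ** (C :: complex ^ 'n ^ 'm)"
  by (simp add: vec_eq_iff matrix_matrix_mult_def left_diff_distrib sum_subtractf)

section \<open>The trace and the Hilbert-Schmidt product\<close>

lemma trace_scale: "trace (map_matrix ((*) c) A) = c * trace (A :: complex ^ 'n ^ 'n)"
  by (simp add: trace_def sum_distrib_left)

lemma trace_adj: "trace (adj A) = cnj (trace A)"
  by (simp add: trace_def)

lemma trace_zero [simp]: "trace (0 :: complex ^ 'n ^ 'n) = 0"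
  by (simp add: trace_def)

lemma trace_sum: "trace (\<Sum>i\<in>I. A i) = (\<Sum>i\<in>I. trace (A i :: complex ^ 'n ^ 'n))"
  by (induction I rule: infinite_finite_induct) (simp_all add: trace_add)

text \<open>This links the trace pairing to the ambient real inner product, so that real orthogonal
  decompositions can be used for it.\<close>

lemma trace_adj_mult_inner:
  fixes A :: "complex ^ 'n ^ 'n"
  shows "Re (trace (adj A ** B)) = A \<bullet> B"
proof -
  have "Re (trace (adj A ** B)) = (\<Sum>i\<in>UNIV. \<Sum>j\<in>UNIV. A $ j $ i \<bullet> B $ j $ i)"
    by (simp add: trace_def matrix_matrix_mult_def inner_complex_def)
  also have "\<dots> = A \<bullet> B"
    by (subst sum.swap) (simp add: inner_vec_def)
  finally show ?thesis .
qed

section \<open>Inner product, self-adjointness and positivity\<close>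

lemma cinner_add_left: "cinner (x + y) z = cinner x z + cinner y z"
  by (simp add: cinner_def algebra_simps sum.distrib)

lemma cinner_add_right: "cinner x (y + z) = cinner x y + cinner x z"
  by (simp add: cinner_def algebra_simps sum.distrib)

lemma cinner_diff_right: "cinner x (y - z) = cinner x y - cinner x z"
  by (simp add: cinner_def algebra_simps sum_subtractf)

lemma cinner_scale_right: "cinner x (c *s y) = c * cinner x y"
  by (simp add: cinner_def sum_distrib_left mult.left_commute)

lemma cinner_zero [simp]: "cinner 0 x = 0" "cinner x 0 = 0"
  by (simp_all add: cinner_def)

lemma cinner_commute: "cinner x y = cnj (cinner y x)"
  by (simp add: cinner_def mult.commute)

lemma cinner_self: "cinner x x = (complex_of_real (norm x))\<^sup>2"
  by (simp flip: norm_eq_cinner)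

lemma cinner_ext:
  assumes "\<And>x. cinner x y = 0"
  shows "y = 0"
  using norm_eq_cinner[of y] assms by simp

lemma cinner_self_adjoint_real:
  assumes "adj S = S"
  shows "cinner x (S *v x) = complex_of_real (Re (cinner x (S *v x)))"
proof -
  have "cinner x (S *v x) = cnj (cinner x (S *v x))"
    by (metis assms cinner_adj cinner_commute)
  then show ?thesis
    by (simp add: complex_eq_iff)
qed

lemma positive_op_iff_real:
  assumes "adj S = S"
  shows "positive_op S \<longleftrightarrow> (\<forall>x. 0 \<le> Re (cinner x (S *v x)))"
  unfolding positive_op_def
  by (metis assms cinner_self_adjoint_real nonneg_Reals_of_real_iff)

lemma cinner_sum_expand:
  "cinner (x + c *s y) (A *v (x + c *s y)) =
    cinner x (A *v x) + c * cinner x (A *v y) + cnj c * cinner y (A *v x)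
    + cnj c * c * cinner y (A *v y)"
  by (simp add: cinner_add_left cinner_add_right matrix_vector_right_distrib cinner_scale_left
      cinner_scale_right vector_scalar_commute algebra_simps)

text \<open>Polarization: the form is real at \<open>x + y\<close> and at
  \<open>x + \<i> *s y\<close>, which compares first the imaginary and then the real parts of the
  two mixed terms.\<close>

lemma positive_op_adj:
  assumes "positive_op A"
  shows "adj A = A"
proof -
  have r: "Im (cinner x (A *v x)) = 0" for x
    using assms by (auto simp: positive_op_def complex_nonneg_Reals_iff)
  have "cinner x (A *v y) = cnj (cinner y (A *v x))" for x y
  proof -
    have "Im (cinner x (A *v y)) + Im (cinner y (A *v x)) = 0"
      using r[of "x + 1 *s y"] r[of x] r[of y] unfolding cinner_sum_expand by simp
    moreover have "Re (cinner x (A *v y)) - Re (cinner y (A *v x)) = 0"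
      using r[of "x + \<i> *s y"] r[of x] r[of y] unfolding cinner_sum_expand by simp
    ultimately show ?thesis
      by (simp add: complex_eq_iff)
  qed
  then have "cinner x (A *v y) = cinner x (adj A *v y)" for x y
    by (metis adj_adj cinner_adj cinner_commute)
  then have "cinner x (A *v y - adj A *v y) = 0" for x y
    by (simp add: cinner_diff_right)
  then have "A *v y - adj A *v y = 0" for y
    using cinner_ext by blast
  then show ?thesis
    by (simp add: matrix_eq)
qed

text \<open>An affine function that is bounded below on the reals has slope zero. The lemma yields
  the eigenvalue equation below and later the common kernel of two positive operators.\<close>

lemma positive_op_null:
  assumes A: "positive_op A" and x: "cinner x (A *v x) = 0"
  shows "A *v x = 0"
proof (rule cinner_ext)
  fix y
  define w where "w = cinner y (A *v x)"
  have w': "cinner x (A *v y) = cnj w"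
    unfolding w_def by (metis A cinner_adj cinner_commute positive_op_adj)
  \<comment> \<open>the quadratic form at \<open>y - s w\<^sup>* x\<close> is affine in the real number \<open>s\<close>\<close>
  have pos: "0 \<le> Re (cinner y (A *v y)) - 2 * s * (cmod w)\<^sup>2" for s
  proof -
    define c where "c = - complex_of_real s * cnj w"
    have "0 \<le> Re (cinner (y + c *s x) (A *v (y + c *s x)))"
      using A by (auto simp: positive_op_def complex_nonneg_Reals_iff)
    also have "\<dots> = Re (cinner y (A *v y)) + Re (c * w) + Re (cnj c * cnj w)"
      unfolding cinner_sum_expand x w' by (simp add: w_def)
    also have "\<dots> = Re (cinner y (A *v y)) - 2 * s * (cmod w)\<^sup>2"
      unfolding cmod_power2 by (simp add: c_def power2_eq_square algebra_simps)
    finally show ?thesis .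
  qed
  show "cinner y (A *v x) = 0"
  proof (rule ccontr)
    assume "cinner y (A *v x) \<noteq> 0"
    then have "0 < (cmod w)\<^sup>2" by (simp add: w_def)
    \<comment> \<open>At this value of \<open>s\<close> the affine form equals -1.\<close>
    moreover have "2 * ((Re (cinner y (A *v y)) + 1) / (2 * (cmod w)\<^sup>2)) * (cmod w)\<^sup>2
        = Re (cinner y (A *v y)) + 1"
      using \<open>0 < (cmod w)\<^sup>2\<close> by (simp add: field_simps)
    ultimately show False
      using pos[of "(Re (cinner y (A *v y)) + 1) / (2 * (cmod w)\<^sup>2)"] by linarith
  qed
qed

text \<open>Both expressions are self-adjoint and together they determine \<open>A\<close>, so a
  vanishing result for self-adjoint operators extends to all operators.\<close>

lemma self_adjoint_parts_0:
  assumes "A + adj A = 0" "map_matrix ((*) \<i>) (A - adj A) = 0"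
  shows "A = 0"
proof -
  have "A $ i $ j = 0" for i j
  proof -
    have "A $ i $ j + cnj (A $ j $ i) = 0"
      using arg_cong[OF assms(1), of "\<lambda>M. M $ i $ j"] by simp
    moreover have "A $ i $ j - cnj (A $ j $ i) = 0"
      using arg_cong[OF assms(2), of "\<lambda>M. M $ i $ j"] by simp
    ultimately show ?thesis by (simp add: complex_eq_iff)
  qed
  then show ?thesis by (simp add: vec_eq_iff)
qed

lemma self_adjoint_parts:
  "adj (A + adj A) = A + adj A"
  "adj (map_matrix ((*) \<i>) (A - adj A)) = map_matrix ((*) \<i>) (A - adj A)"
  by (simp_all add: vec_eq_iff algebra_simps)

text \<open>The bound is uniform relative to \<open>(norm x)\<^sup>2\<close>, so a small multiple of
  \<open>S\<close> is dominated by the identity.\<close>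

lemma quadratic_form_bound:
  obtains K where "0 < K" "\<And>x. \<bar>Re (cinner x (S *v x))\<bar> \<le> K * (norm x)\<^sup>2"
proof -
  obtain K where K: "0 < K" "\<And>x. norm (S *v x) \<le> norm x * K"
    using bounded_linear.pos_bounded[OF linear_linear[THEN iffD2, OF matrix_vector_mul_linear[of S]]]
    by auto
  show ?thesis
  proof
    fix x
    have "\<bar>Re (cinner x (S *v x))\<bar> \<le> norm x * norm (S *v x)"
      using Cauchy_Schwarz_ineq2[of x "S *v x"] by (simp add: inner_eq_Re_cinner)
    also have "\<dots> \<le> norm x * (norm x * K)"
      by (intro mult_left_mono K) simp
    finally show "\<bar>Re (cinner x (S *v x))\<bar> \<le> K * (norm x)\<^sup>2"
      by (simp add: power2_eq_square mult_ac)
  qed (fact K)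
qed

section \<open>Factoring through a possibly singular operator\<close>

text \<open>A linear right inverse of \<open>X\<close> on its range serves as \<open>Y\<close>. Then
  \<open>Y ** X\<close> is an idempotent with the same kernel as \<open>X\<close>.\<close>

lemma generalized_inverse:
  fixes X :: "complex ^ 'n ^ 'm"
  obtains Y where "X ** Y ** X = X"
proof -
  obtain g where g: "Vector_Spaces.linear (*s) (*s) g" "\<And>v. v \<in> range ((*v) X) \<Longrightarrow> X *v g v = v"
    using vec.linear_exists_right_inverse_on[OF matrix_vector_mul_linear_gen[of X] vec.subspace_UNIV]
    by blast
  have "X ** matrix g ** X = X"
    using g by (simp add: matrix_eq matrix_works flip: matrix_vector_mul_assoc)
  then show ?thesis by (rule that)
qed

text \<open>Subtracting from a vector its image under \<open>Y ** X\<close> gives a vector in the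
  kernel of \<open>X\<close>, so \<open>B\<close> and \<open>adj B\<close> both absorb
  \<open>Y ** X\<close> on the right. Taking adjoints moves one of the two factors to the left of
  \<open>B\<close>.\<close>

lemma factor_through:
  fixes B X :: "complex ^ 'n ^ 'n"
  assumes "\<And>x. X *v x = 0 \<Longrightarrow> B *v x = 0" "\<And>x. X *v x = 0 \<Longrightarrow> adj B *v x = 0"
  obtains Z where "B = adj X ** Z ** X"
proof -
  obtain Y where Y: "X ** Y ** X = X"
    using generalized_inverse by blast
  have absorb: "C ** (Y ** X) = C" if C: "\<And>x. X *v x = 0 \<Longrightarrow> C *v x = 0" for C :: "complex ^ 'n ^ 'n"
  proof -
    have "C *v (x - (Y ** X) *v x) = 0" for x
      by (rule C) (simp add: matrix_vector_mult_diff_distrib matrix_vector_mul_assoc matrix_mul_assoc Y)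
    then show ?thesis
      by (simp add: matrix_eq matrix_vector_mult_diff_distrib flip: matrix_vector_mul_assoc)
  qed
  have "adj (Y ** X) ** B = B"
    using arg_cong[OF absorb[OF assms(2)], of adj] by (simp add: adj_mult)
  then have "B = adj (Y ** X) ** (B ** (Y ** X))"
    using absorb[OF assms(1)] by simp
  also have "\<dots> = adj X ** (adj Y ** B ** Y) ** X"
    by (simp add: adj_mult matrix_mul_assoc)
  finally show ?thesis by (rule that)
qed

text \<open>All matrix elements of \<open>Z\<close> between vectors of the range vanish, and
  \<open>Z\<close> lives on the range only.\<close>

lemma ops_on_eq_0:
  assumes Z: "Z \<in> ops_on (range ((*v) X))" and 0: "adj X ** Z ** X = 0"
  shows "Z = 0"
proof -
  have range: "vec.subspace (range ((*v) X))"
    by (metis matrix_vector_mul_linear_gen vec.linear_subspace_image vec.subspace_UNIV)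
  have "Z *v (X *v v) = 0" for v
  proof (rule orth_compl_disjoint)
    show "Z *v (X *v v) \<in> range ((*v) X)"
      using Z by (simp add: ops_on_def)
    have "cinner (X *v w) (Z *v (X *v v)) = cinner w ((adj X ** Z ** X) *v v)" for w
      by (simp add: cinner_adj flip: matrix_vector_mul_assoc)
    then show "Z *v (X *v v) \<in> orth_compl (range ((*v) X))"
      by (auto simp: orth_compl_def 0)
  qed
  moreover have "Z *v x = 0" if "x \<in> orth_compl (range ((*v) X))" for x
    using Z that by (simp add: ops_on_def)
  ultimately have "Z *v x = 0" for x
    by (rule_tac orth_decomposition[OF range, of x]) (auto simp: matrix_vector_right_distrib)
  then show ?thesis
    by (simp add: matrix_eq)
qed

section \<open>Orthogonal projections and the existence of eigenvectors\<close>

lemma orth_proj_onto_positive: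
  assumes K: "vec.subspace K" and P: "orth_proj_onto P K"
  shows "positive_op P"
  unfolding positive_op_def
proof
  fix x
  obtain y z where x: "y \<in> K" "z \<in> orth_compl K" "x = y + z"
    using orth_decomposition[OF K] .
  then have "cinner y z = 0" "P *v x = y"
    using P by (auto simp: orth_compl_def orth_proj_onto_def matrix_vector_right_distrib)
  then have "cinner x (P *v x) = complex_of_real ((norm y)\<^sup>2)"
    using cinner_commute[of z y] by (simp add: x cinner_self cinner_add_left)
  then show "cinner x (P *v x) \<in> \<real>\<^sub>\<ge>\<^sub>0" by (simp del: of_real_power)
qed

lemma orth_proj_onto_in:
  assumes K: "vec.subspace K" and P: "orth_proj_onto P K"
  shows "P *v x \<in> K"
proof -
  obtain y z where x: "y \<in> K" "z \<in> orth_compl K" "x = y + z"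
    using orth_decomposition[OF K] .
  then show ?thesis
    using P by (auto simp: orth_proj_onto_def matrix_vector_right_distrib)
qed

lemma orth_proj_onto_idem:
  assumes K: "vec.subspace K" and P: "orth_proj_onto P K"
  shows "P ** P = P"
  using orth_proj_onto_in[OF assms] P
  by (simp add: matrix_eq orth_proj_onto_def flip: matrix_vector_mul_assoc)

text \<open>The trace of an orthogonal projection is its squared Hilbert-Schmidt norm.\<close>

lemma orth_proj_onto_trace:
  assumes K: "vec.subspace K" and P: "orth_proj_onto P K" and "K \<noteq> {0}"
  shows "trace P \<noteq> 0"
proof
  assume "trace P = 0"
  then have "P \<bullet> P = 0"
    using trace_adj_mult_inner[of P P] positive_op_adj[OF orth_proj_onto_positive[OF K P]]
      orth_proj_onto_idem[OF K P] by simp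
  then have "P = 0" by simp
  then have "x = 0" if "x \<in> K" for x
    using P that by (auto simp: orth_proj_onto_def)
  then show False
    using \<open>K \<noteq> {0}\<close> vec.subspace_0[OF K] by auto
qed

lemma cinner_proj:
  assumes "adj P = P"
  shows "cinner x ((P ** S ** P) *v x) = cinner (P *v x) (S *v (P *v x))"
  by (simp add: cinner_adj assms flip: matrix_vector_mul_assoc)

text \<open>The maximum of the quadratic form over the unit sphere of \<open>K\<close> is an eigenvalue.\<close>

lemma self_adjoint_eigenvector:
  assumes K: "vec.subspace K" "K \<noteq> {0}" and P: "orth_proj_onto P K"
    and S: "adj S = S" "P ** S ** P = S"
  obtains c x where "x \<in> K" "x \<noteq> 0" "S *v x = c *s x"
proof -
  define f where "f x = Re (cinner x (S *v x))" for x
  obtain x0 where "x0 \<in> K" "x0 \<noteq> 0"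
    using K vec.subspace_0 by blast
  have K': "subspace K"
    by (rule subspace_if_vec_subspace[OF K(1)])
  have normalize: "(1 / norm x) *\<^sub>R x \<in> sphere 0 1 \<inter> K" if "x \<in> K" "x \<noteq> 0" for x
    using that subspace_scale[OF K'] by auto
  have "compact (sphere 0 1 \<inter> K)"
    using closed_subspace[OF K'] by (intro compact_Int_closed) auto
  moreover have "sphere 0 1 \<inter> K \<noteq> {}"
    using normalize \<open>x0 \<in> K\<close> \<open>x0 \<noteq> 0\<close> by blast
  moreover have "continuous_on (sphere 0 1 \<inter> K) f"
    unfolding f_def cinner_def matrix_vector_mult_def by (intro continuous_intros)
  ultimately obtain x where x: "x \<in> sphere 0 1 \<inter> K" and max: "\<And>y. y \<in> sphere 0 1 \<inter> K \<Longrightarrow> f y \<le> f x"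
    using continuous_attains_sup by metis
  \<comment> \<open>\<open>f\<close> is homogeneous of degree two, so the bound on the sphere
    spreads to all of \<open>K\<close>.\<close>
  have le: "f y \<le> f x * (norm y)\<^sup>2" if "y \<in> K" for y
  proof (cases "y = 0")
    case False
    have "f ((1 / norm y) *\<^sub>R y) = f y / (norm y)\<^sup>2"
      by (simp add: f_def scaleR_vec_eq cinner_scale_left cinner_scale_right vector_scalar_commute
          power2_eq_square flip: of_real_divide)
    then show ?thesis
      using max[OF normalize[OF that False]] False by (simp add: pos_divide_le_eq)
  qed (simp add: f_def)
  \<comment> \<open>Maximality makes \<open>N\<close> positive and its form vanishes at
    \<open>x\<close>; hence \<open>N\<close> annihilates \<open>x\<close>, which is the eigenvalue
    equation.\<close>
  define N where "N = map_matrix ((*) (complex_of_real (f x))) P - S"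
  have P': "adj P = P"
    by (rule positive_op_adj[OF orth_proj_onto_positive[OF K(1) P]])
  have "adj N = N"
    by (simp add: N_def adj_diff adj_scale P' S)
  moreover have "0 \<le> Re (cinner y (N *v y))" for y
  proof -
    \<comment> \<open>Both forms depend on \<open>P *v y\<close> only, so the bound on
      \<open>K\<close> is enough for every \<open>y\<close>.\<close>
    have "cinner y (P *v y) = cinner (P *v y) (P *v y)"
      using cinner_proj[OF P', of y "mat 1"] by (simp add: orth_proj_onto_idem[OF K(1) P])
    moreover have "cinner y (S *v y) = cinner (P *v y) (S *v (P *v y))"
      using cinner_proj[OF P', of y S] by (simp add: S)
    ultimately have "Re (cinner y (N *v y)) = f x * (norm (P *v y))\<^sup>2 - f (P *v y)"
      by (simp add: N_def matrix_vector_mult_diff_rdistrib cinner_diff_right matrix_vector_mult_scale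
          cinner_scale_right f_def cinner_self)
    then show ?thesis
      using le[OF orth_proj_onto_in[OF K(1) P]] by simp
  qed
  ultimately have "positive_op N"
    by (simp add: positive_op_iff_real)
  have Px: "P *v x = x"
    using P x by (simp add: orth_proj_onto_def)
  have Nx: "N *v x = complex_of_real (f x) *s x - S *v x"
    by (simp add: N_def matrix_vector_mult_diff_rdistrib matrix_vector_mult_scale Px)
  have "cinner x (N *v x) = 0"
    using x cinner_self_adjoint_real[OF S(1), of x, folded f_def, symmetric]
    by (simp add: Nx cinner_diff_right cinner_scale_right cinner_self)
  then have "N *v x = 0"
    by (rule positive_op_null[OF \<open>positive_op N\<close>])
  then have "S *v x = complex_of_real (f x) *s x"
    by (simp add: Nx)
  moreover have "x \<in> K" "x \<noteq> 0" using x by auto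
  ultimately show ?thesis using that by blast
qed

section \<open>Schur's lemma\<close>

definition commutant ::
    "('g, 'b) monoid_scheme \<Rightarrow> ('g \<Rightarrow> complex ^ 'n ^ 'n) \<Rightarrow> (complex ^ 'n ^ 'n) set" where
  "commutant G U = {S. \<forall>g\<in>carrier G. S ** U g = U g ** S}"

lemma commutant_mult: "S \<in> commutant G U \<Longrightarrow> R \<in> commutant G U \<Longrightarrow> S ** R \<in> commutant G U"
  unfolding commutant_def by simp (metis matrix_mul_assoc)

lemma commutant_add: "S \<in> commutant G U \<Longrightarrow> R \<in> commutant G U \<Longrightarrow> S + R \<in> commutant G U"
  by (simp add: commutant_def matrix_add_ldistrib matrix_add_rdistrib)

lemma commutant_diff: "S \<in> commutant G U \<Longrightarrow> R \<in> commutant G U \<Longrightarrow> S - R \<in> commutant G U"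
  by (simp add: commutant_def matrix_diff_ldistrib matrix_diff_rdistrib)

lemma commutant_scale: "S \<in> commutant G U \<Longrightarrow> map_matrix ((*) c) S \<in> commutant G U"
  by (simp add: commutant_def matrix_mult_scale_left matrix_mult_scale_right)

text \<open>Taking adjoints gives commutation with \<open>adj (U g)\<close>, the inverse of
  \<open>U g\<close>; multiplying by \<open>U g\<close> on both sides leads back to
  \<open>U g\<close>.\<close>

lemma commutant_adj:
  assumes "\<And>g. g \<in> carrier G \<Longrightarrow> unitary_op (U g)" "S \<in> commutant G U"
  shows "adj S \<in> commutant G U"
  unfolding commutant_def
proof (intro CollectI ballI)
  fix g assume g: "g \<in> carrier G"
  have u: "adj (U g) ** U g = mat 1" "U g ** adj (U g) = mat 1"
    using assms(1)[OF g] by (simp_all add: unitary_op_def)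
  have "adj (U g) ** adj S = adj S ** adj (U g)"
    using assms(2) g by (simp add: commutant_def flip: adj_mult)
  then have "U g ** (adj (U g) ** adj S) ** U g = U g ** (adj S ** adj (U g)) ** U g"
    by simp
  then show "adj S ** U g = U g ** adj S"
    by (simp add: matrix_mul_assoc u) (simp add: u flip: matrix_mul_assoc)
qed

lemma commutant_apply:
  "S \<in> commutant G U \<Longrightarrow> g \<in> carrier G \<Longrightarrow> S *v (U g *v x) = U g *v (S *v x)"
  by (simp add: commutant_def matrix_vector_mul_assoc)

section \<open>Irreducible subspaces and intertwiners\<close>

lemma irreducible_subspaceD:
  assumes "irreducible_subspace G U K"
  shows "vec.subspace K" "K \<noteq> {0}" "\<And>g x. g \<in> carrier G \<Longrightarrow> x \<in> K \<Longrightarrow> U g *v x \<in> K"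
  using assms by (auto simp: irreducible_subspace_def invariant_subspace_def)

lemma irreducible_subspace_cases:
  assumes "irreducible_subspace G U K" "vec.subspace L" "L \<subseteq> K"
    "\<And>g x. g \<in> carrier G \<Longrightarrow> x \<in> L \<Longrightarrow> U g *v x \<in> L"
  shows "L = {0} \<or> L = K"
  using assms by (auto simp: irreducible_subspace_def invariant_subspace_def)

text \<open>An eigenspace of \<open>S\<close> inside \<open>K\<close> is invariant and nonzero,
  hence all of \<open>K\<close>. So \<open>S\<close> is a multiple of \<open>P\<close>, and the
  trace forces the factor to be zero.\<close>

lemma schur_self_adjoint:
  assumes irr: "irreducible_subspace G U K" and P: "orth_proj_onto P K"
    and S: "adj S = S" "P ** S ** P = S" "S \<in> commutant G U" "trace S = 0"
  shows "S = 0"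
proof -
  note K = irreducible_subspaceD[OF irr]
  obtain c x where x: "x \<in> K" "x \<noteq> 0" "S *v x = c *s x"
    using self_adjoint_eigenvector[OF K(1,2) P S(1,2)] .
  define L where "L = {y \<in> K. S *v y = c *s y}"
  have "L = {0} \<or> L = K"
  proof (rule irreducible_subspace_cases[OF irr])
    show "vec.subspace L"
      using K(1) by (auto simp: L_def vec.subspace_def matrix_vector_right_distrib
          vector_scalar_commute vec.scale_right_distrib mult.commute)
    show "U g *v y \<in> L" if "g \<in> carrier G" "y \<in> L" for g y
      using that K(3) by (simp add: L_def commutant_apply[OF S(3)] vector_scalar_commute)
  qed (auto simp: L_def)
  then have L: "S *v y = c *s y" if "y \<in> K" for y
    using x that unfolding L_def by blast
  have "S *v y = map_matrix ((*) c) P *v y" for y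
  proof -
    have "S *v y = P *v (S *v (P *v y))"
      by (subst S(2)[symmetric]) (simp flip: matrix_vector_mul_assoc)
    also have "\<dots> = c *s (P *v (P *v y))"
      by (simp add: L[OF orth_proj_onto_in[OF K(1) P]] vector_scalar_commute)
    also have "\<dots> = map_matrix ((*) c) P *v y"
      by (simp add: matrix_vector_mul_assoc orth_proj_onto_idem[OF K(1) P] matrix_vector_mult_scale)
    finally show ?thesis .
  qed
  then have eq: "S = map_matrix ((*) c) P"
    by (simp add: matrix_eq)
  then have "c = 0"
    using S(4) orth_proj_onto_trace[OF K(1) P K(2)] by (simp add: trace_scale)
  then show ?thesis
    by (simp add: eq vec_eq_iff)
qed

text \<open>The two self-adjoint parts of \<open>S\<close> inherit its compression to
  \<open>K\<close>, its commutation and its zero trace.\<close>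

lemma schur_trace_zero:
  assumes U: "\<And>g. g \<in> carrier G \<Longrightarrow> unitary_op (U g)"
    and irr: "irreducible_subspace G U K" and P: "orth_proj_onto P K"
    and S: "P ** S ** P = S" "S \<in> commutant G U" "trace S = 0"
  shows "S = 0"
proof (rule self_adjoint_parts_0)
  have "adj P = P"
    using positive_op_adj orth_proj_onto_positive irreducible_subspaceD(1)[OF irr] P by blast
  then have PS: "P ** adj S ** P = adj S"
    using arg_cong[OF S(1), of adj] by (simp add: adj_mult matrix_mul_assoc)
  note adjS = commutant_adj[OF U S(2)]
  show "S + adj S = 0"
  proof (rule schur_self_adjoint[OF irr P self_adjoint_parts(1)])
    show "P ** (S + adj S) ** P = S + adj S"
      by (simp add: matrix_add_ldistrib matrix_add_rdistrib S PS)
  qed (simp_all add: commutant_add S adjS trace_add trace_adj)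
  show "map_matrix ((*) \<i>) (S - adj S) = 0"
  proof (rule schur_self_adjoint[OF irr P self_adjoint_parts(2)])
    show "P ** map_matrix ((*) \<i>) (S - adj S) ** P = map_matrix ((*) \<i>) (S - adj S)"
      by (simp add: matrix_mult_scale_left matrix_mult_scale_right matrix_diff_ldistrib
          matrix_diff_rdistrib S PS)
  qed (simp_all add: commutant_scale commutant_diff S adjS trace_scale trace_sub trace_adj)
qed

text \<open>The kernel within \<open>K\<close> and the image within \<open>L\<close> are invariant.
  As \<open>V\<close> is not zero on \<open>K\<close>, irreducibility makes the kernel trivial and
  the image all of \<open>L\<close>.\<close>

lemma schur_intertwiner:
  assumes K: "irreducible_subspace G U K" and L: "irreducible_subspace G U L"
    and V: "V \<in> commutant G U" "\<And>x. x \<in> K \<Longrightarrow> V *v x \<in> L"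
    and nz: "x \<in> K" "V *v x \<noteq> 0"
  shows "(K, L) \<in> equivalent_irreps G U"
proof -
  note K' = irreducible_subspaceD[OF K] and L' = irreducible_subspaceD[OF L]
  have "{y \<in> K. V *v y = 0} = {0} \<or> {y \<in> K. V *v y = 0} = K"
  proof (rule irreducible_subspace_cases[OF K])
    show "vec.subspace {y \<in> K. V *v y = 0}"
      using K'(1) by (auto simp: vec.subspace_def matrix_vector_right_distrib vector_scalar_commute)
  qed (use K'(3) in \<open>auto simp: commutant_apply[OF V(1)]\<close>)
  with nz have ker: "{y \<in> K. V *v y = 0} = {0}" by auto
  have "inj_on ((*v) V) K"
  proof (rule inj_onI)
    fix y z assume yz: "y \<in> K" "z \<in> K" "V *v y = V *v z"
    then have "y - z \<in> {y \<in> K. V *v y = 0}"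
      using K'(1) by (simp add: vec.subspace_diff matrix_vector_mult_diff_distrib)
    then show "y = z" unfolding ker by simp
  qed
  moreover have "(*v) V ` K = {0} \<or> (*v) V ` K = L"
  proof (rule irreducible_subspace_cases[OF L])
    show "vec.subspace ((*v) V ` K)"
      by (rule vec.linear_subspace_image[OF matrix_vector_mul_linear_gen K'(1)])
  qed (use V(2) K'(3) in \<open>auto simp flip: commutant_apply[OF V(1)]\<close>)
  with nz have "(*v) V ` K = L" by auto
  ultimately have "bij_betw ((*v) V) K L"
    by (simp add: bij_betw_def)
  then show ?thesis
    using K L commutant_apply[OF V(1)] by (auto simp: equivalent_irreps_def)
qed

text \<open>This makes the quotient usable: members of a class are irreducible, and classes with
  equivalent members coincide.\<close>

lemma equiv_equivalent_irreps: "equiv (Collect (irreducible_subspace G U)) (equivalent_irreps G U)"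
proof (rule equivI)
  show "equivalent_irreps G U \<subseteq> Collect (irreducible_subspace G U) \<times> Collect (irreducible_subspace G U)"
    by (auto simp: equivalent_irreps_def)
  show "refl_on (Collect (irreducible_subspace G U)) (equivalent_irreps G U)"
    by (auto simp: refl_on_def equivalent_irreps_def bij_betw_def inj_on_def intro!: exI[of _ "mat 1"])
  show "sym (equivalent_irreps G U)"
  proof (rule symI)
    fix K L assume "(K, L) \<in> equivalent_irreps G U"
    then obtain V where irr: "irreducible_subspace G U K" "irreducible_subspace G U L"
      and V: "bij_betw ((*v) V) K L" "\<And>g x. g \<in> carrier G \<Longrightarrow> x \<in> K \<Longrightarrow> V *v (U g *v x) = U g *v (V *v x)"
      by (auto simp: equivalent_irreps_def)
    \<comment> \<open>The left inverse on \<open>K\<close> is linear on the whole space, so it is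
      given by a matrix, as \<open>equivalent_irreps\<close> demands.\<close>
    obtain h where h: "Vector_Spaces.linear (*s) (*s) h" "\<And>v. v \<in> K \<Longrightarrow> h (V *v v) = v"
      using vec.linear_exists_left_inverse_on[OF matrix_vector_mul_linear_gen[of V]
          irreducible_subspaceD(1)[OF irr(1)] bij_betw_imp_inj_on[OF V(1)]] by blast
    have W: "matrix h *v (V *v v) = v" if "v \<in> K" for v
      by (simp add: matrix_works[OF h(1)] h(2)[OF that])
    have L: "L = (*v) V ` K"
      using V(1) by (simp add: bij_betw_def)
    have "bij_betw ((*v) (matrix h)) L K"
      unfolding L by (rule bij_betw_imageI) (auto simp: W inj_on_def image_image)
    moreover have "matrix h *v (U g *v y) = U g *v (matrix h *v y)"
      if "g \<in> carrier G" "y \<in> L" for g y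
      using that irreducible_subspaceD(3)[OF irr(1)] by (auto simp: L W simp flip: V(2))
    ultimately show "(L, K) \<in> equivalent_irreps G U"
      using irr by (auto simp: equivalent_irreps_def)
  qed
  show "trans (equivalent_irreps G U)"
  proof (rule transI)
    fix J K L assume "(J, K) \<in> equivalent_irreps G U" "(K, L) \<in> equivalent_irreps G U"
    then obtain V W where irr: "irreducible_subspace G U J" "irreducible_subspace G U L"
      and V: "bij_betw ((*v) V) J K" "\<And>g x. g \<in> carrier G \<Longrightarrow> x \<in> J \<Longrightarrow> V *v (U g *v x) = U g *v (V *v x)"
      and W: "bij_betw ((*v) W) K L" "\<And>g x. g \<in> carrier G \<Longrightarrow> x \<in> K \<Longrightarrow> W *v (U g *v x) = U g *v (W *v x)"
      by (auto simp: equivalent_irreps_def)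
    have "(*v) (W ** V) = (*v) W \<circ> (*v) V"
      by (auto simp: matrix_vector_mul_assoc)
    then have "bij_betw ((*v) (W ** V)) J L"
      using bij_betw_trans[OF V(1) W(1)] by simp
    moreover have "(W ** V) *v (U g *v x) = U g *v ((W ** V) *v x)" if "g \<in> carrier G" "x \<in> J" for g x
      using that V W bij_betwE[OF V(1)] by (simp flip: matrix_vector_mul_assoc)
    ultimately show "(J, L) \<in> equivalent_irreps G U"
      using irr by (auto simp: equivalent_irreps_def)
  qed
qed

text \<open>Instead of expanding an element of the commutant in the \<open>T \<mu> k l\<close>, it suffices that the
  \<open>T \<mu> k l\<close> separate the points of the commutant in the trace pairing.\<close>

lemma commutant_eq_0:
  assumes U: "\<And>g. g \<in> carrier G \<Longrightarrow> unitary_op (U g)"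
    and H: "irreducible_decomposition G U m H" and T: "invariant_isomorphisms G U m H T"
    and S: "S \<in> commutant G U"
    and 0: "\<And>\<mu> k l. \<mu> \<in> irrep_classes G U \<Longrightarrow> k \<in> {1..m \<mu>} \<Longrightarrow> l \<in> {1..m \<mu>} \<Longrightarrow> trace (T \<mu> k l ** S) = 0"
  shows "S = 0"
proof -
  let ?I = "Sigma (irrep_classes G U) (\<lambda>\<mu>. {1..m \<mu>})"
  have irr: "irreducible_subspace G U (H \<mu> k)" if "(\<mu>, k) \<in> ?I" for \<mu> k
  proof -
    have "H \<mu> k \<in> \<mu>" "\<mu> \<in> Collect (irreducible_subspace G U) // equivalent_irreps G U"
      using H that by (auto simp: irreducible_decomposition_def irrep_classes_def)
    then show ?thesis
      using in_quotient_imp_subset[OF equiv_equivalent_irreps] by fastforce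
  qed
  have P: "orth_proj_onto (T \<mu> k k) (H \<mu> k)" and TC: "\<And>l. l \<in> {1..m \<mu>} \<Longrightarrow> T \<mu> k l \<in> commutant G U"
    and TT: "\<And>l n. l \<in> {1..m \<mu>} \<Longrightarrow> n \<in> {1..m \<mu>} \<Longrightarrow> T \<mu> k l ** T \<mu> l n = T \<mu> k n"
    if "(\<mu>, k) \<in> ?I" for \<mu> k
    using T that by (auto simp: invariant_isomorphisms_def commutant_def)
  have same: "T \<mu> k k ** S ** T \<mu> l l = 0" if k: "(\<mu>, k) \<in> ?I" and l: "(\<mu>, l) \<in> ?I" for \<mu> k l
  proof -
    have kl: "\<mu> \<in> irrep_classes G U" "k \<in> {1..m \<mu>}" "l \<in> {1..m \<mu>}"
      using k l by auto
    \<comment> \<open>\<open>T \<mu> l k\<close> transports the block of \<open>S\<close> from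
      subspace \<open>l\<close> to subspace \<open>k\<close> back to \<open>l\<close>. Thus
      \<open>R\<close> acts on one irreducible subspace, its trace is the pairing of
      \<open>T \<mu> l k\<close> with \<open>S\<close>, and \<open>T \<mu> k l\<close> undoes the
      transport.\<close>
    define R where "R = T \<mu> l k ** S ** T \<mu> l l"
    have "R = 0"
    proof (rule schur_trace_zero[OF U irr[OF l] P[OF l]])
      have "T \<mu> l l ** R ** T \<mu> l l = (T \<mu> l l ** T \<mu> l k) ** S ** (T \<mu> l l ** T \<mu> l l)"
        by (simp only: R_def matrix_mul_assoc)
      then show "T \<mu> l l ** R ** T \<mu> l l = R"
        using kl by (simp add: R_def TT[OF l])
      show "R \<in> commutant G U"
        unfolding R_def using kl by (intro commutant_mult S TC[OF l])
      have "trace R = trace ((T \<mu> l l ** T \<mu> l k) ** S)"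
        unfolding R_def by (subst trace_mul_sym) (simp add: matrix_mul_assoc)
      then show "trace R = 0"
        using kl by (simp add: TT[OF l] 0)
    qed
    moreover have "T \<mu> k l ** R = (T \<mu> k l ** T \<mu> l k) ** S ** T \<mu> l l"
      by (simp only: R_def matrix_mul_assoc)
    ultimately show ?thesis
      using kl by (simp add: TT[OF k])
  qed
  have diff: "T \<mu> k k *v (S *v x) = 0" if k: "(\<mu>, k) \<in> ?I" and l: "(\<mu>', l) \<in> ?I" and x: "x \<in> H \<mu>' l"
    for \<mu> k \<mu>' l x
  proof (cases "\<mu> = \<mu>'")
    case True
    have "T \<mu> k k *v (S *v x) = (T \<mu> k k ** S ** T \<mu> l l) *v x"
      using P[OF l] x True by (simp add: orth_proj_onto_def flip: matrix_vector_mul_assoc)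
    then show ?thesis
      using same[OF k] l True by simp
  next
    case False
    show ?thesis
    \<comment> \<open>A nonzero block would be an intertwiner between irreducible subspaces of
      different classes.\<close>
    proof (rule ccontr)
      assume "T \<mu> k k *v (S *v x) \<noteq> 0"
      then have "(H \<mu>' l, H \<mu> k) \<in> equivalent_irreps G U"
        using TC[OF k] k S irreducible_subspaceD(1)[OF irr[OF k]] orth_proj_onto_in[OF _ P[OF k]]
        by (intro schur_intertwiner[OF irr[OF l] irr[OF k], of "T \<mu> k k ** S" x])
          (auto intro!: commutant_mult x simp flip: matrix_vector_mul_assoc)
      moreover have "H \<mu>' l \<in> \<mu>'" "H \<mu> k \<in> \<mu>"
        "\<mu> \<in> Collect (irreducible_subspace G U) // equivalent_irreps G U"
        "\<mu>' \<in> Collect (irreducible_subspace G U) // equivalent_irreps G U"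
        using H k l by (auto simp: irreducible_decomposition_def irrep_classes_def)
      ultimately have "\<mu>' = \<mu>"
        using quotient_eqI[OF equiv_equivalent_irreps] by metis
      with False show False by simp
    qed
  qed
  let ?W = "\<Union>\<mu>\<in>irrep_classes G U. \<Union>k\<in>{1..m \<mu>}. H \<mu> k"
  have W: "vec.span ?W = UNIV"
    using H by (simp add: irreducible_decomposition_def)
  have "S *v x = 0" if "x \<in> ?W" for x
  proof (rule cinner_ext)
    have w: "cinner w (S *v x) = 0" if w: "w \<in> ?W" for w
    proof -
      obtain \<mu> k \<mu>' l where k: "(\<mu>, k) \<in> ?I" "w \<in> H \<mu> k" and l: "(\<mu>', l) \<in> ?I" "x \<in> H \<mu>' l"
        using w \<open>x \<in> ?W\<close> by auto
      \<comment> \<open>The projection fixes \<open>w\<close> and is self-adjoint, so it can be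
        moved to the other side, where \<open>diff\<close> applies.\<close>
      have "cinner w (S *v x) = cinner (T \<mu> k k *v w) (S *v x)"
        using P[OF k(1)] k(2) by (simp add: orth_proj_onto_def)
      also have "\<dots> = cinner w (T \<mu> k k *v (S *v x))"
        using positive_op_adj[OF orth_proj_onto_positive[OF irreducible_subspaceD(1)[OF irr[OF k(1)]] P[OF k(1)]]]
        by (simp add: cinner_adj)
      also have "\<dots> = 0"
        using diff[OF k(1) l(1,2)] by simp
      finally show ?thesis .
    qed
    have "vec.subspace {w. cinner w (S *v x) = 0}"
      by (simp add: vec.subspace_def cinner_add_left cinner_scale_left)
    then have "vec.span ?W \<subseteq> {w. cinner w (S *v x) = 0}"
      using w by (intro vec.span_minimal) auto
    then show "cinner w (S *v x) = 0" for w
      unfolding W by auto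
  qed
  moreover have "vec.subspace {x. S *v x = 0}"
    by (simp add: vec.subspace_def matrix_vector_right_distrib vector_scalar_commute)
  ultimately have "vec.span ?W \<subseteq> {x. S *v x = 0}"
    by (intro vec.span_minimal) auto
  then show ?thesis
    unfolding W by (auto simp: matrix_eq)
qed

section \<open>Averaging over the group\<close>

definition twirl :: "'g measure \<Rightarrow> ('g \<Rightarrow> complex ^ 'n ^ 'n) \<Rightarrow> complex ^ 'n ^ 'n \<Rightarrow> complex ^ 'n ^ 'n" where
  "twirl \<nu> U Y = (LINT g|\<nu>. U g ** Y ** adj (U g))"

locale covariant_rep = compact_lie_group G \<tau> \<Phi>
  for G :: "('g, 'b) monoid_scheme" (structure)
    and \<tau> :: "'g topology"
    and \<Phi> :: "('g set \<times> ('g \<Rightarrow> 'e::real_normed_vector)) set" +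
  fixes \<nu> :: "'g measure"
    and U :: "'g \<Rightarrow> complex ^ 'n ^ 'n"
  assumes haar: "normalized_haar_measure G \<tau> \<nu>"
    and rep: "projective_unitary_rep G \<tau> U"
begin

section \<open>The Haar measure and its invariance under translations\<close>

lemma space_haar: "space \<nu> = carrier G"
  using haar topspace_eq by (simp add: normalized_haar_measure_def)

lemma sets_haar: "sets \<nu> = sigma_sets (topspace \<tau>) {S. openin \<tau> S}"
  using haar by (simp add: normalized_haar_measure_def)

lemma openin_sets_haar: "openin \<tau> S \<Longrightarrow> S \<in> sets \<nu>"
  by (simp add: sets_haar)

lemma emeasure_haar: "emeasure \<nu> (space \<nu>) = 1"
  using haar unfolding normalized_haar_measure_def by blast

lemma finite_measure_haar: "finite_measure \<nu>"
  by (rule finite_measureI) (simp add: emeasure_haar)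

lemma unitary: "g \<in> carrier G \<Longrightarrow> unitary_op (U g)"
  using rep by (simp add: projective_unitary_rep_def)

lemma unitary_cancel:
  assumes "g \<in> carrier G"
  shows "adj (U g) ** U g = mat 1" "U g ** adj (U g) = mat 1"
  using unitary[OF assms] by (simp_all add: unitary_op_def)

lemma left_mult_continuous: "h \<in> carrier G \<Longrightarrow> continuous_map \<tau> \<tau> (\<lambda>g. h \<otimes> g)"
proof -
  assume "h \<in> carrier G"
  then have "continuous_map \<tau> (prod_topology \<tau> \<tau>) (\<lambda>g. (h, g))"
    by (intro continuous_map_pairedI) (simp_all add: topspace_eq)
  from continuous_map_compose[OF this continuous_mult] show ?thesis
    by (simp add: comp_def)
qed

lemma left_mult_measurable: "h \<in> carrier G \<Longrightarrow> (\<lambda>g. h \<otimes> g) \<in> measurable \<nu> \<nu>"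
proof (rule measurable_sigma_sets[OF sets_haar])
  assume h: "h \<in> carrier G"
  then show "(\<lambda>g. h \<otimes> g) \<in> space \<nu> \<rightarrow> topspace \<tau>"
    by (auto simp: space_haar topspace_eq)
  fix S assume "S \<in> {S. openin \<tau> S}"
  then have "openin \<tau> {x \<in> topspace \<tau>. h \<otimes> x \<in> S}"
    using left_mult_continuous[OF h] by (auto simp: continuous_map_def)
  moreover have "{x \<in> topspace \<tau>. h \<otimes> x \<in> S} = (\<lambda>g. h \<otimes> g) -` S \<inter> space \<nu>"
    by (auto simp: space_haar topspace_eq)
  ultimately show "(\<lambda>g. h \<otimes> g) -` S \<inter> space \<nu> \<in> sets \<nu>"
    using openin_sets_haar by simp
qed (auto dest: openin_subset)

text \<open>The preimage of \<open>E\<close> under translation by \<open>h\<close> is its translate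
  by \<open>inv h\<close>. Invariance of the image measure is the form needed for substitution in
  integrals.\<close>

lemma distr_left_mult:
  assumes h: "h \<in> carrier G"
  shows "distr \<nu> \<nu> (\<lambda>g. h \<otimes> g) = \<nu>"
proof (rule measure_eqI)
  fix E assume "E \<in> sets (distr \<nu> \<nu> (\<lambda>g. h \<otimes> g))"
  then have E: "E \<in> sets \<nu>" by simp
  then have "E \<subseteq> carrier G"
    using sets.sets_into_space space_haar by blast
  have "(\<lambda>g. h \<otimes> g) -` E \<inter> space \<nu> = inv h <# E"
  proof (intro equalityI subsetI)
    fix x assume "x \<in> (\<lambda>g. h \<otimes> g) -` E \<inter> space \<nu>"
    then have "x = inv h \<otimes> (h \<otimes> x)" "h \<otimes> x \<in> E"
      using h by (auto simp: space_haar simp flip: m_assoc)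
    then show "x \<in> inv h <# E"
      by (auto simp: l_coset_def)
  next
    fix x assume "x \<in> inv h <# E"
    then show "x \<in> (\<lambda>g. h \<otimes> g) -` E \<inter> space \<nu>"
      using h \<open>E \<subseteq> carrier G\<close> by (auto simp: l_coset_def space_haar subset_iff simp flip: m_assoc)
  qed
  then show "emeasure (distr \<nu> \<nu> (\<lambda>g. h \<otimes> g)) E = emeasure \<nu> E"
    using haar h E by (simp add: emeasure_distr left_mult_measurable normalized_haar_measure_def)
qed simp

section \<open>Integrability of the conjugated operators\<close>

lemma conj_continuous: "continuous_map \<tau> euclidean (\<lambda>g. U g ** Y ** adj (U g))"
  using rep by (simp add: projective_unitary_rep_def)

lemma conj_measurable: "(\<lambda>g. U g ** Y ** adj (U g)) \<in> borel_measurable \<nu>"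
proof (rule borel_measurableI)
  fix S :: "(complex ^ 'n ^ 'n) set" assume "open S"
  then have "openin \<tau> {g \<in> topspace \<tau>. U g ** Y ** adj (U g) \<in> S}"
    using conj_continuous[of Y] by (auto simp: continuous_map_def)
  moreover have "{g \<in> topspace \<tau>. U g ** Y ** adj (U g) \<in> S} = (\<lambda>g. U g ** Y ** adj (U g)) -` S \<inter> space \<nu>"
    by (auto simp: space_haar topspace_eq)
  ultimately show "(\<lambda>g. U g ** Y ** adj (U g)) -` S \<inter> space \<nu> \<in> sets \<nu>"
    using openin_sets_haar by simp
qed

text \<open>Continuity on a compact space gives boundedness, and the measure is finite.\<close>

lemma conj_integrable: "integrable \<nu> (\<lambda>g. U g ** Y ** adj (U g))"
proof -
  have "compactin \<tau> (topspace \<tau>)"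
    using compact_space by (simp add: compact_space_def)
  then have "compactin euclidean ((\<lambda>g. U g ** Y ** adj (U g)) ` topspace \<tau>)"
    by (rule image_compactin[OF _ conj_continuous])
  then have "bounded ((\<lambda>g. U g ** Y ** adj (U g)) ` topspace \<tau>)"
    by (intro compact_imp_bounded) simp
  then obtain B where B: "\<forall>M\<in>(\<lambda>g. U g ** Y ** adj (U g)) ` topspace \<tau>. norm M \<le> B"
    unfolding bounded_iff by (rule exE)
  show ?thesis
  proof (rule finite_measure.integrable_const_bound[OF finite_measure_haar _ conj_measurable])
    show "AE g in \<nu>. norm (U g ** Y ** adj (U g)) \<le> B"
      by (rule AE_I2) (use B in \<open>simp add: space_haar topspace_eq\<close>)
  qed
qed

section \<open>Algebra of the group average\<close>

text \<open>Scaling, the adjoint, the trace and conjugation by \<open>U h\<close> all pass through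
  the integral this way. Real linearity is the right notion, as the adjoint is
  conjugate-linear.\<close>

lemma twirl_bounded_linear:
  assumes "bounded_linear f"
  shows "(LINT g|\<nu>. f (U g ** Y ** adj (U g))) = f (twirl \<nu> U Y)"
  unfolding twirl_def by (rule integral_bounded_linear[OF assms conj_integrable])

lemma twirl_add: "twirl \<nu> U (Y + Z) = twirl \<nu> U Y + twirl \<nu> U Z"
  unfolding twirl_def
  by (simp add: matrix_add_ldistrib matrix_add_rdistrib conj_integrable flip: Bochner_Integration.integral_add)

lemma twirl_scale: "twirl \<nu> U (map_matrix ((*) c) Y) = map_matrix ((*) c) (twirl \<nu> U Y)"
proof -
  have "linear (map_matrix ((*) c) :: complex ^ 'n ^ 'n \<Rightarrow> _)"
    by (rule linearI) (simp_all add: vec_eq_iff algebra_simps)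
  from twirl_bounded_linear[OF linear_linear[THEN iffD2, OF this], of Y] show ?thesis
    by (simp add: twirl_def matrix_mult_scale_left matrix_mult_scale_right)
qed

lemma twirl_adj: "twirl \<nu> U (adj Y) = adj (twirl \<nu> U Y)"
proof -
  have "linear (adj :: complex ^ 'n ^ 'n \<Rightarrow> _)"
    by (rule linearI) (simp_all add: vec_eq_iff algebra_simps)
  from twirl_bounded_linear[OF linear_linear[THEN iffD2, OF this], of Y] show ?thesis
    by (simp add: twirl_def adj_mult matrix_mul_assoc)
qed

lemma twirl_0 [simp]: "twirl \<nu> U 0 = 0"
  using twirl_add[of 0 0] by simp

lemma twirl_sum: "twirl \<nu> U (\<Sum>i\<in>I. Y i) = (\<Sum>i\<in>I. twirl \<nu> U (Y i))"
  by (induction I rule: infinite_finite_induct) (simp_all add: twirl_add)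

lemma twirl_diff: "twirl \<nu> U (Y - Z) = twirl \<nu> U Y - twirl \<nu> U Z"
  using twirl_add[of "Y - Z" Z] by simp

text \<open>Moving \<open>S\<close> past \<open>U g\<close> and cycling the trace cancels the
  unitaries, so the integrand is constant and the total mass is 1.\<close>

lemma trace_twirl:
  assumes S: "S \<in> commutant G U"
  shows "trace (S ** twirl \<nu> U Y) = trace (S ** Y)"
proof -
  have "linear (\<lambda>M. trace (S ** M))"
    by (rule linearI) (simp_all add: matrix_add_ldistrib trace_add scaleR_matrix_eq
        matrix_mult_scale_right trace_scale scaleR_conv_of_real)
  from twirl_bounded_linear[OF linear_linear[THEN iffD2, OF this], of Y]
  have "trace (S ** twirl \<nu> U Y) = (LINT g|\<nu>. trace (S ** (U g ** Y ** adj (U g))))"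
    by simp
  also have "\<dots> = (LINT g|\<nu>. trace (S ** Y))"
  proof (rule Bochner_Integration.integral_cong)
    fix g assume "g \<in> space \<nu>"
    then have g: "g \<in> carrier G" by (simp add: space_haar)
    have "S ** (U g ** Y ** adj (U g)) = U g ** (S ** Y ** adj (U g))"
      using S g by (simp add: commutant_def matrix_mul_assoc)
    also have "trace \<dots> = trace (S ** Y ** (adj (U g) ** U g))"
      by (subst trace_mul_sym) (simp add: matrix_mul_assoc)
    finally show "trace (S ** (U g ** Y ** adj (U g))) = trace (S ** Y)"
      by (simp add: unitary_cancel[OF g])
  qed simp
  also have "\<dots> = trace (S ** Y)"
    by (simp add: measure_def emeasure_haar)
  finally show ?thesis .
qed

text \<open>The phase meets its conjugate and cancels, so a projective representation acts by
  conjugation as a genuine one.\<close>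

lemma conj_mult:
  assumes "h \<in> carrier G" "g \<in> carrier G"
  shows "U (h \<otimes> g) ** Y ** adj (U (h \<otimes> g)) = U h ** (U g ** Y ** adj (U g)) ** adj (U h)"
proof -
  obtain \<omega> where \<omega>: "cmod \<omega> = 1" "U (h \<otimes> g) = map_matrix ((*) \<omega>) (U h ** U g)"
    using rep assms unfolding projective_unitary_rep_def by meson
  have "cnj \<omega> * \<omega> = 1"
    using complex_norm_square[of \<omega>] \<omega>(1) by (simp add: mult.commute)
  then have "map_matrix ((*) (cnj \<omega>)) (map_matrix ((*) \<omega>) M) = M" for M :: "complex ^ 'n ^ 'n"
    by (simp add: vec_eq_iff flip: mult.assoc)
  then show ?thesis
    by (simp add: \<omega>(2) adj_scale matrix_mult_scale_left matrix_mult_scale_right adj_mult matrix_mul_assoc)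
qed

text \<open>Conjugation by \<open>U h\<close> translates the integration variable, which leaves the
  Haar integral unchanged.\<close>

lemma twirl_commutant: "twirl \<nu> U Y \<in> commutant G U"
  unfolding commutant_def
proof (intro CollectI ballI)
  fix h assume h: "h \<in> carrier G"
  have "linear (\<lambda>M. U h ** M ** adj (U h))"
    by (rule linearI) (simp_all add: matrix_add_ldistrib matrix_add_rdistrib scaleR_matrix_eq
        matrix_mult_scale_left matrix_mult_scale_right)
  from twirl_bounded_linear[OF linear_linear[THEN iffD2, OF this], of Y, symmetric]
  have "U h ** twirl \<nu> U Y ** adj (U h) = (LINT g|\<nu>. U h ** (U g ** Y ** adj (U g)) ** adj (U h))" .
  also have "\<dots> = (LINT g|\<nu>. U (h \<otimes> g) ** Y ** adj (U (h \<otimes> g)))"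
    by (rule Bochner_Integration.integral_cong) (simp_all add: conj_mult h space_haar)
  also have "\<dots> = (LINT g|distr \<nu> \<nu> (\<lambda>g. h \<otimes> g). U g ** Y ** adj (U g))"
    by (rule integral_distr[OF left_mult_measurable[OF h] conj_measurable, symmetric])
  also have "\<dots> = twirl \<nu> U Y"
    by (simp add: distr_left_mult[OF h] twirl_def)
  finally have "U h ** twirl \<nu> U Y ** adj (U h) ** U h = twirl \<nu> U Y ** U h"
    by simp
  then show "twirl \<nu> U Y ** U h = U h ** twirl \<nu> U Y"
    by (simp add: unitary_cancel[OF h] flip: matrix_mul_assoc)
qed

end

section \<open>Extreme points\<close>

lemma trace_cycle:
  fixes X :: "complex ^ 'n ^ 'n"
  shows "trace (X ** T ** Y ** Z) = trace (T ** (Y ** Z ** X))"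
  by (metis matrix_mul_assoc trace_mul_sym)

lemma block_subspace_block_ops_on:
  assumes "\<And>i. vec.subspace (K i)"
  shows "block.subspace (block_ops_on K)"
  using assms
  by (auto simp: block.subspace_def block_ops_on_def ops_on_def block_scale_def
      matrix_vector_mult_scale matrix_vector_mult_add_rdistrib vec.subspace_def)

text \<open>Complex spans of block operators thereby become accessible to real orthogonal
  decomposition.\<close>

lemma subspace_if_block_subspace:
  assumes "block.subspace S"
  shows "subspace (S :: ((complex ^ 'n ^ 'n), 'i::finite) vec set)"
proof -
  have "c *\<^sub>R A = block_scale (complex_of_real c) A" for c and A :: "((complex ^ 'n ^ 'n), 'i::finite) vec"
    by (simp add: block_scale_def scaleR_matrix_eq vec_eq_iff[of "c *\<^sub>R A"])
  with assms show ?thesis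
    by (auto simp: subspace_def block.subspace_def)
qed

context covariant_rep
begin

lemma covariant_set_iff:
  "A \<in> covariant_set \<nu> U \<longleftrightarrow> (\<forall>i. positive_op (A $ i)) \<and> twirl \<nu> U (\<Sum>i\<in>UNIV. A $ i) = mat 1"
  by (simp add: covariant_set_def twirl_sum) (simp add: twirl_def)

text \<open>The direction has average zero and is dominated by the given point, so small steps of
  both signs stay in the set; at an extreme point such a direction must vanish.\<close>

lemma extreme_point_perturbation:
  fixes X :: "'i::finite \<Rightarrow> complex ^ 'n ^ 'n"
  assumes ext: "(\<chi> i. adj (X i) ** X i) extreme_point_of covariant_set \<nu> U"
    and S: "\<And>i. adj (S i) = S i"
    and 0: "twirl \<nu> U (\<Sum>i\<in>UNIV. adj (X i) ** S i ** X i) = 0"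
  shows "adj (X i) ** S i ** X i = 0"
proof -
  let ?A = "\<chi> i. adj (X i) ** X i"
  define P where "P s = (\<chi> i. adj (X i) ** X i + s *\<^sub>R (adj (X i) ** S i ** X i))" for s
  have A: "?A \<in> covariant_set \<nu> U"
    using ext by (simp add: extreme_point_of_def)
  have "\<exists>K>0. \<forall>x. \<bar>Re (cinner x (S i *v x))\<bar> \<le> K * (norm x)\<^sup>2" for i
    using quadratic_form_bound[of "S i"] by metis
  then obtain K where K: "\<And>i. 0 < K i" "\<And>i x. \<bar>Re (cinner x (S i *v x))\<bar> \<le> K i * (norm x)\<^sup>2"
    by metis
  \<comment> \<open>The sum bounds every \<open>K i\<close>, so one step size works for all
    blocks.\<close>
  define t where "t = 1 / (\<Sum>i\<in>UNIV. K i)"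
  have sum_pos: "0 < (\<Sum>i\<in>UNIV. K i)"
    using K(1) by (intro sum_pos) auto
  then have t: "0 < t" by (simp add: t_def)
  have tK: "t * K i \<le> 1" for i
    using sum_pos member_le_sum[of i UNIV K] K(1) by (simp add: t_def less_imp_le)
  have P: "P s \<in> covariant_set \<nu> U" if s: "\<bar>s\<bar> \<le> t" for s
    unfolding covariant_set_iff
  proof (intro conjI allI)
    fix i
    have "adj (P s $ i) = P s $ i"
      by (simp add: P_def adj_add adj_mult S matrix_mul_assoc scaleR_matrix_eq adj_scale)
    moreover have "0 \<le> Re (cinner x (P s $ i *v x))" for x
    proof -
      let ?y = "X i *v x"
      have "Re (cinner x (P s $ i *v x)) = (norm ?y)\<^sup>2 + s * Re (cinner ?y (S i *v ?y))"
        by (simp add: P_def matrix_vector_mult_add_rdistrib cinner_add_right scaleR_matrix_eq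
            matrix_vector_mult_scale cinner_scale_right cinner_adj[of x "adj (X i)"] cinner_self
            Re_power_real flip: matrix_vector_mul_assoc)
      moreover have "\<bar>s * Re (cinner ?y (S i *v ?y))\<bar> \<le> t * (K i * (norm ?y)\<^sup>2)"
        unfolding abs_mult using s t K(1)[of i] K(2)[of ?y i] by (intro mult_mono) auto
      moreover have "t * (K i * (norm ?y)\<^sup>2) \<le> (norm ?y)\<^sup>2"
        using mult_right_mono[OF tK[of i], of "(norm ?y)\<^sup>2"] by (simp add: mult.assoc)
      ultimately show ?thesis by linarith
    qed
    ultimately show "positive_op (P s $ i)"
      by (simp add: positive_op_iff_real)
  next
    have "(\<Sum>i\<in>UNIV. P s $ i)
        = (\<Sum>i\<in>UNIV. ?A $ i) + s *\<^sub>R (\<Sum>i\<in>UNIV. adj (X i) ** S i ** X i)"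
      by (simp add: P_def sum.distrib scaleR_sum_right)
    then have "twirl \<nu> U (\<Sum>i\<in>UNIV. P s $ i) = mat 1 + s *\<^sub>R (0 :: complex ^ 'n ^ 'n)"
      using A unfolding covariant_set_iff
      by (simp only: twirl_add scaleR_matrix_eq twirl_scale 0)
    then show "twirl \<nu> U (\<Sum>i\<in>UNIV. P s $ i) = mat 1" by simp
  qed
  \<comment> \<open>Otherwise \<open>?A\<close> would be the midpoint of a proper segment in the
    set.\<close>
  have "P t = P (- t)"
  proof (rule ccontr)
    assume "P t \<noteq> P (- t)"
    moreover have "?A = (1 - 1 / 2) *\<^sub>R P t + (1 / 2) *\<^sub>R P (- t)"
      unfolding vec_eq_iff[of ?A] by (simp add: P_def algebra_simps flip: scaleR_add_left)
    ultimately have "?A \<in> open_segment (P t) (P (- t))"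
      unfolding in_segment by (intro conjI exI[of _ "1 / 2"]) auto
    moreover have "P t \<in> covariant_set \<nu> U" "P (- t) \<in> covariant_set \<nu> U"
      using t by (auto intro!: P)
    ultimately show False
      using ext unfolding extreme_point_of_def by blast
  qed
  then have "P t $ i = P (- t) $ i" by simp
  then have "t *\<^sub>R (adj (X i) ** S i ** X i) = - (t *\<^sub>R (adj (X i) ** S i ** X i))"
    by (simp add: P_def)
  then have "t *\<^sub>R (adj (X i) ** S i ** X i) = 0"
    by (simp only: eq_neg_iff_add_eq_0 flip: scaleR_2) simp
  then show ?thesis
    using t by simp
qed

end

theorem theorem2:
  fixes G :: "('g, 'b) monoid_scheme"
    and \<tau> :: "'g topology"
    and \<Phi> :: "('g set \<times> ('g \<Rightarrow> 'e::real_normed_vector)) set"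
    and \<nu> :: "'g measure"
    and U :: "'g \<Rightarrow> complex ^ 'n ^ 'n"
    and m :: "(complex ^ 'n) set set \<Rightarrow> nat"
    and H :: "(complex ^ 'n) set set \<Rightarrow> nat \<Rightarrow> (complex ^ 'n) set"
    and T :: "(complex ^ 'n) set set \<Rightarrow> nat \<Rightarrow> nat \<Rightarrow> complex ^ 'n ^ 'n"
    and X :: "'i::finite \<Rightarrow> complex ^ 'n ^ 'n"
  assumes "compact_lie_group G \<tau> \<Phi>"
    and "normalized_haar_measure G \<tau> \<nu>"
    and "projective_unitary_rep G \<tau> U"
    and "irreducible_decomposition G U m H"
    and "invariant_isomorphisms G U m H T"
    and "(\<chi> i. adj (X i) ** X i) \<in> covariant_set \<nu> U"
  shows "(\<chi> i. adj (X i) ** X i) extreme_point_of covariant_set \<nu> U \<longleftrightarrow>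
    block.span {F_op X (T \<mu> k l) | \<mu> k l. \<mu> \<in> irrep_classes G U \<and> k \<in> {1..m \<mu>} \<and> l \<in> {1..m \<mu>}}
      = block_ops_on (\<lambda>i. range ((*v) (X i)))"
    (is "?A extreme_point_of ?C \<longleftrightarrow> block.span ?F = ?B")
proof -
  interpret covariant_rep G \<tau> \<Phi> \<nu> U
    using assms(1-3) by (intro covariant_rep.intro covariant_rep_axioms.intro)
  have TC: "T \<mu> k l \<in> commutant G U"
    if "\<mu> \<in> irrep_classes G U" "k \<in> {1..m \<mu>}" "l \<in> {1..m \<mu>}" for \<mu> k l
    using assms(5) that by (auto simp: invariant_isomorphisms_def commutant_def)
  show ?thesis
  proof
    assume ext: "?A extreme_point_of ?C"
    have "block.subspace ?B"
      using vec.linear_subspace_image[OF matrix_vector_mul_linear_gen vec.subspace_UNIV]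
      by (intro block_subspace_block_ops_on)
    moreover have "?F \<subseteq> ?B"
      using F_op_in_block_ops_on by blast
    ultimately have sub: "block.span ?F \<subseteq> ?B"
      by (intro block.span_minimal)
    have "W \<in> block.span ?F" if W: "W \<in> ?B" for W
    proof -
      \<comment> \<open>\<open>z\<close> is the component of \<open>W\<close> orthogonal to the
        span, for the real inner product; the aim is \<open>z = 0\<close>.\<close>
      obtain y z where y: "y \<in> span (block.span ?F)"
        and z: "\<And>w. w \<in> span (block.span ?F) \<Longrightarrow> orthogonal z w" and yz: "W = y + z"
        using orthogonal_subspace_decomp_exists[of "block.span ?F" W] by blast
      have span: "span (block.span ?F) = block.span ?F"
        using subspace_if_block_subspace[OF block.subspace_span] span_eq_iff by blast
      have "z = W - y"
        using yz by simp
      then have "z \<in> ?B"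
        using W y sub block.subspace_diff[OF \<open>block.subspace ?B\<close>] unfolding span by blast
      \<comment> \<open>The span is complex, so real orthogonality to \<open>w\<close> and to
        \<open>\<i>\<close> times \<open>w\<close> yields both parts of complex
        orthogonality.\<close>
      have "(\<Sum>i\<in>UNIV. trace (adj (z $ i) ** w $ i)) = 0" if w: "w \<in> block.span ?F" for w
      proof -
        have Re: "Re (\<Sum>i\<in>UNIV. trace (adj (z $ i) ** w $ i)) = z \<bullet> w" for w
          by (simp add: trace_adj_mult_inner inner_vec_def[of z])
        have "z \<bullet> w = 0" "z \<bullet> block_scale \<i> w = 0"
          using z w block.span_scale[OF w] unfolding span orthogonal_def by blast+
        moreover have "(\<Sum>i\<in>UNIV. trace (adj (z $ i) ** block_scale \<i> w $ i))
            = \<i> * (\<Sum>i\<in>UNIV. trace (adj (z $ i) ** w $ i))"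
          by (simp add: block_scale_def matrix_mult_scale_right trace_scale sum_distrib_left)
        ultimately show ?thesis
          using Re[of w] Re[of "block_scale \<i> w"] by (simp add: complex_eq_iff)
      qed
      note orth = this
      define M where "M i = adj (X i) ** z $ i ** X i" for i
      have adjM: "adj (M i) = adj (X i) ** adj (z $ i) ** X i" for i
        by (simp add: M_def adj_mult matrix_mul_assoc)
      \<comment> \<open>The pairing is conjugate-linear in \<open>z\<close>, hence the adjoints: by
        cyclicity, orthogonality to the generators says that this average has zero trace against
        every \<open>T \<mu> k l\<close>.\<close>
      have "twirl \<nu> U (\<Sum>i\<in>UNIV. adj (M i)) = 0"
      proof (rule commutant_eq_0[OF unitary assms(4,5) twirl_commutant])
        fix \<mu> k l assume kl: "\<mu> \<in> irrep_classes G U" "k \<in> {1..m \<mu>}" "l \<in> {1..m \<mu>}"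
        have "trace (T \<mu> k l ** (\<Sum>i\<in>UNIV. adj (M i)))
            = (\<Sum>i\<in>UNIV. trace (X i ** T \<mu> k l ** adj (X i) ** adj (z $ i)))"
          by (simp add: matrix_sum_left trace_sum adjM trace_cycle)
        also have "\<dots> = (\<Sum>i\<in>UNIV. trace (adj (z $ i) ** F_op X (T \<mu> k l) $ i))"
          by (subst trace_mul_sym) (simp add: F_op_def)
        also have "\<dots> = 0"
          using kl by (intro orth block.span_base) blast
        finally show "trace (T \<mu> k l ** twirl \<nu> U (\<Sum>i\<in>UNIV. adj (M i))) = 0"
          by (simp add: trace_twirl[OF TC[OF kl]])
      qed
      then have tw: "(\<Sum>i\<in>UNIV. adj (twirl \<nu> U (M i))) = 0"
        by (simp add: twirl_sum twirl_adj)
      then have tw': "(\<Sum>i\<in>UNIV. twirl \<nu> U (M i)) = 0"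
        by (auto simp: vec_eq_iff simp flip: cnj_sum)
      have "z $ i = 0" for i
      proof (rule ops_on_eq_0)
        show "z $ i \<in> ops_on (range ((*v) (X i)))"
          using \<open>z \<in> ?B\<close> by (simp add: block_ops_on_def)
        \<comment> \<open>Perturbations must be self-adjoint, so \<open>z\<close> is replaced by its
          two self-adjoint parts, which correspond to those of \<open>M i\<close>.\<close>
        have plus: "adj (X i) ** (z $ i + adj (z $ i)) ** X i = M i + adj (M i)" for i
          by (simp add: adjM) (simp add: M_def matrix_add_ldistrib matrix_add_rdistrib)
        have minus: "adj (X i) ** map_matrix ((*) \<i>) (z $ i - adj (z $ i)) ** X i
            = map_matrix ((*) \<i>) (M i - adj (M i))" for i
          by (simp add: adjM) (simp add: M_def matrix_diff_ldistrib matrix_diff_rdistrib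
              matrix_mult_scale_left matrix_mult_scale_right)
        have "M i = 0"
        proof (rule self_adjoint_parts_0)
          show "M i + adj (M i) = 0"
            using extreme_point_perturbation[OF ext, of "\<lambda>i. z $ i + adj (z $ i)" i]
            by (simp add: plus self_adjoint_parts twirl_sum twirl_add twirl_adj sum.distrib tw tw')
          have "(\<Sum>i\<in>UNIV. twirl \<nu> U (map_matrix ((*) \<i>) (M i - adj (M i))))
              = map_matrix ((*) \<i>) ((\<Sum>i\<in>UNIV. twirl \<nu> U (M i)) - (\<Sum>i\<in>UNIV. adj (twirl \<nu> U (M i))))"
            by (simp add: twirl_scale twirl_diff twirl_adj vec_eq_iff sum_subtractf sum_distrib_left
                right_diff_distrib)
          also have "\<dots> = 0"
            by (simp add: tw tw' vec_eq_iff)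
          finally show "map_matrix ((*) \<i>) (M i - adj (M i)) = 0"
            using extreme_point_perturbation[OF ext, of "\<lambda>i. map_matrix ((*) \<i>) (z $ i - adj (z $ i))" i]
            by (simp add: minus self_adjoint_parts twirl_sum)
        qed
        then show "adj (X i) ** z $ i ** X i = 0"
          by (simp add: M_def)
      qed
      then have "z = 0" by (simp add: vec_eq_iff[of z])
      then show ?thesis
        using y yz unfolding span by simp
    qed
    with sub show "block.span ?F = ?B" by blast
  next
    assume span: "block.span ?F = ?B"
    show "?A extreme_point_of ?C"
      unfolding extreme_point_of_def
    proof (intro conjI ballI notI)
      show "?A \<in> ?C" by fact
      fix a b assume a: "a \<in> ?C" and b: "b \<in> ?C" and "?A \<in> open_segment a b"
      then obtain u where ne: "a \<noteq> b" and u: "0 < u" "u < 1" "?A = (1 - u) *\<^sub>R a + u *\<^sub>R b"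
        unfolding in_segment by blast
      have pos: "positive_op (a $ i)" "positive_op (b $ i)" for i
        using a b by (simp_all add: covariant_set_iff)
      define B where "B i = b $ i - a $ i" for i
      \<comment> \<open>On the kernel of \<open>X i\<close> the forms of \<open>a\<close> and
        \<open>b\<close> are nonnegative with a vanishing strict convex combination, so each of them
        vanishes.\<close>
      have ker: "B i *v x = 0" if x: "X i *v x = 0" for i x
      proof -
        have "adj (X i) ** X i = (1 - u) *\<^sub>R (a $ i) + u *\<^sub>R (b $ i)"
          using arg_cong[OF u(3), of "\<lambda>A. A $ i"] by simp
        moreover have "(adj (X i) ** X i) *v x = 0"
          by (simp add: x flip: matrix_vector_mul_assoc)
        ultimately have "((1 - u) *\<^sub>R (a $ i) + u *\<^sub>R (b $ i)) *v x = 0"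
          by simp
        then have "cinner x (((1 - u) *\<^sub>R (a $ i) + u *\<^sub>R (b $ i)) *v x) = 0"
          by simp
        then have 0: "complex_of_real (1 - u) * cinner x (a $ i *v x)
            + complex_of_real u * cinner x (b $ i *v x) = 0"
          by (simp only: matrix_vector_mult_add_rdistrib cinner_add_right scaleR_matrix_eq
              matrix_vector_mult_scale cinner_scale_right)
        have nn: "0 \<le> Re (cinner x (a $ i *v x))" "Im (cinner x (a $ i *v x)) = 0"
          "0 \<le> Re (cinner x (b $ i *v x))" "Im (cinner x (b $ i *v x)) = 0"
          using pos[of i] by (auto simp: positive_op_def complex_nonneg_Reals_iff)
        have "(1 - u) * Re (cinner x (a $ i *v x)) + u * Re (cinner x (b $ i *v x)) = 0"
          using arg_cong[OF 0, of Re] by simp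
        then have "Re (cinner x (a $ i *v x)) = 0" "Re (cinner x (b $ i *v x)) = 0"
          using u nn by (simp_all add: add_nonneg_eq_0_iff)
        then have "cinner x (a $ i *v x) = 0" "cinner x (b $ i *v x) = 0"
          using nn by (simp_all add: complex_eq_iff)
        then show ?thesis
          by (simp add: B_def matrix_vector_mult_diff_rdistrib positive_op_null[OF pos(1)]
              positive_op_null[OF pos(2)])
      qed
      have "adj (B i) = B i" for i
        using pos[of i] by (simp add: B_def adj_diff positive_op_adj)
      then have "\<exists>Z. B i = adj (X i) ** Z ** X i" for i
        using factor_through[of "X i" "B i"] ker by metis
      then obtain Z where Z: "\<And>i. B i = adj (X i) ** Z i ** X i"
        by metis
      have cyc: "trace (X i ** R ** adj (X i) ** Z i) = trace (R ** B i)" for i R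
        by (simp add: trace_cycle Z)
      \<comment> \<open>\<open>?V\<close> is the annihilator of \<open>Z\<close> in the trace
        pairing. It contains the generators because \<open>a\<close> and \<open>b\<close> have the
        same average, and then all of \<open>?B\<close> by the spanning hypothesis.\<close>
      let ?V = "{w. (\<Sum>i\<in>UNIV. trace (w $ i ** Z i)) = 0}"
      have "twirl \<nu> U (\<Sum>i\<in>UNIV. B i) = 0"
        using a b by (simp add: covariant_set_iff B_def sum_subtractf twirl_diff)
      then have "F_op X (T \<mu> k l) \<in> ?V"
        if "\<mu> \<in> irrep_classes G U" "k \<in> {1..m \<mu>}" "l \<in> {1..m \<mu>}" for \<mu> k l
        using trace_twirl[OF TC[OF that], of "\<Sum>i\<in>UNIV. B i"]
        by (simp add: F_op_def cyc matrix_sum_left trace_sum)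
      then have "?F \<subseteq> ?V" by blast
      moreover have "block.subspace ?V"
        by (simp add: block.subspace_def block_scale_def matrix_add_rdistrib trace_add sum.distrib
            matrix_mult_scale_left trace_scale flip: sum_distrib_left)
      ultimately have "?B \<subseteq> ?V"
        unfolding span[symmetric] by (intro block.span_minimal)
      \<comment> \<open>The middle factor may vary with the block; with \<open>adj (B i)\<close> the
        pairing with \<open>Z\<close> becomes the sum of the squared norms of the
        \<open>B i\<close>.\<close>
      moreover have "(\<chi> i. X i ** adj (B i) ** adj (X i)) \<in> ?B"
        using F_op_in_block_ops_on[of X] by (simp add: block_ops_on_def F_op_def)
      ultimately have "(\<Sum>i\<in>UNIV. trace (adj (B i) ** B i)) = 0"
        by (auto simp: cyc)
      then have "(\<Sum>i\<in>UNIV. B i \<bullet> B i) = 0"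
        by (simp flip: trace_adj_mult_inner Re_sum)
      then have "B i = 0" for i
        by (simp add: sum_nonneg_eq_0_iff)
      then have "a = b"
        unfolding vec_eq_iff[of a] by (simp add: B_def)
      with ne show False ..
    qed
  qed
qed

end
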